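(* Let $d\ge 1$ be an integer and $p \in \mathbb{R}[x_1,\dots,x_d]$. Then the following are equivalent: (i) $p(\xi) \ge 0$ for all $\xi \in \mathbb{R}^d$; (ii) for every real $\epsilon > 0$ there is $N\in \mathbb{N}_0$ such that $$p + \epsilon \sum_{n=0}^N \sum_{j=1}^d \frac{x_j^{2n}}{n!} \in \Sigma;$$ (ii') for every real $\epsilon > 0$ there is $N\in \mathbb{N}_0$ such that $$p + \epsilon \sum_{n=0}^N \sum_{j=1}^d \frac{x_j^{2n}}{(2n)!} \in \Sigma.$$
   Context: $\mathbb{N}_0=\{0,1,2,\dots\}$. $\Sigma=\{\sum_{\ell=1}^k p_\ell^2 : k\in\mathbb{N}_0,\ p_1,\dots,p_k\in\mathbb{R}[x_1,\dots,x_d]\}$ is the convex cone of sums of squares of polynomials in $\mathbb{R}[x_1,\dots,x_d]$. *)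

theory Defs
  imports "HOL-Analysis.Analysis" "HOL-Library.Poly_Mapping"
begin

text \<open>
  The type \<open>'n rpoly\<close> is the polynomial ring over the reals in the variables \<open>x\<^sub>j\<close>, \<open>j :: 'n\<close>:
  a monomial is its exponent vector, a polynomial is its finitely supported coefficient function,
  and the ring operations (convolution product) are those of \<open>Poly_Mapping\<close>.
  For a finite index type, \<open>d = CARD('n)\<close>.
\<close>

type_synonym 'n rpoly = "('n \<Rightarrow>\<^sub>0 nat) \<Rightarrow>\<^sub>0 real"

definition pconst :: "real \<Rightarrow> 'n rpoly" where
  "pconst c = Poly_Mapping.single 0 c"

definition pvar :: "'n \<Rightarrow> 'n rpoly" where
  "pvar j = Poly_Mapping.single (Poly_Mapping.single j 1) 1"

definition peval :: "('n::finite) rpoly \<Rightarrow> real ^ 'n \<Rightarrow> real" where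
  "peval p \<xi> = (\<Sum>m\<in>Poly_Mapping.keys p.
     Poly_Mapping.lookup p m * (\<Prod>j\<in>UNIV. (\<xi> $ j) ^ Poly_Mapping.lookup m j))"

definition sos :: "'n rpoly set" where
  "sos = {q. \<exists>(k::nat) f. q = (\<Sum>l=1..k. (f l)\<^sup>2)}"

lemma peval_superset:
  assumes "finite A" "Poly_Mapping.keys p \<subseteq> A"
  shows "peval p \<xi> = (\<Sum>m\<in>A.
     Poly_Mapping.lookup p m * (\<Prod>j\<in>UNIV. (\<xi> $ j) ^ Poly_Mapping.lookup m j))"
  unfolding peval_def using assms
  by (intro sum.mono_neutral_left) (auto simp: in_keys_iff)

lemma peval_zero [simp]: "peval 0 \<xi> = 0"
  by (simp add: peval_def)

lemma peval_single:
  "peval (Poly_Mapping.single m c) \<xi> = c * (\<Prod>j\<in>UNIV. (\<xi> $ j) ^ Poly_Mapping.lookup m j)"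
  by (subst peval_superset[of "{m}"]) auto

lemma peval_pconst [simp]: "peval (pconst c) \<xi> = c"
  by (simp add: pconst_def peval_single)

lemma peval_one [simp]: "peval 1 \<xi> = 1"
  using peval_pconst[of 1 \<xi>] by (simp add: pconst_def)

lemma peval_pvar [simp]: "peval (pvar j) \<xi> = \<xi> $ j"
proof -
  have "(\<Prod>i\<in>UNIV. (\<xi> $ i) ^ Poly_Mapping.lookup (Poly_Mapping.single j 1) i)
      = (\<Prod>i\<in>UNIV. if i = j then \<xi> $ i else 1)"
    by (rule prod.cong) (auto simp: lookup_single when_def)
  then show ?thesis by (simp add: pvar_def peval_single)
qed

lemma peval_add [simp]: "peval (p + q) \<xi> = peval p \<xi> + peval q \<xi>"
proof -
  let ?A = "Poly_Mapping.keys p \<union> Poly_Mapping.keys q"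
  show ?thesis
    using Poly_Mapping.keys_add[of p q]
    by (simp add: peval_superset[of ?A] lookup_add distrib_right sum.distrib)
qed

lemma peval_sum: "peval (\<Sum>i\<in>I. f i) \<xi> = (\<Sum>i\<in>I. peval (f i) \<xi>)"
  by (induction I rule: infinite_finite_induct) auto

lemma rpoly_sum_single:
  "(p :: 'n rpoly) = (\<Sum>m\<in>Poly_Mapping.keys p. Poly_Mapping.single m (Poly_Mapping.lookup p m))"
  by (rule poly_mapping_eqI)
     (auto simp: lookup_sum lookup_single when_def in_keys_iff sum.delta)

lemma peval_mult [simp]: "peval (p * q) \<xi> = peval p \<xi> * peval q \<xi>"
proof -
  have "p * q = (\<Sum>m\<in>Poly_Mapping.keys p. \<Sum>n\<in>Poly_Mapping.keys q.
      Poly_Mapping.single (m + n) (Poly_Mapping.lookup p m * Poly_Mapping.lookup q n))"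
    by (subst (1) rpoly_sum_single[of p], subst (1) rpoly_sum_single[of q])
       (simp add: sum_product mult_single)
  also have "peval \<dots> \<xi> = peval p \<xi> * peval q \<xi>"
    by (simp add: peval_sum peval_single lookup_add power_add prod.distrib
        peval_def[of p] peval_def[of q] sum_product algebra_simps)
  finally show ?thesis .
qed

lemma peval_power [simp]: "peval (p ^ n) \<xi> = peval p \<xi> ^ n"
  by (induction n) auto

end

theory Submission
  imports Defs "HOL-Real_Asymp.Real_Asymp"
begin

text \<open>
  Write \<open>\<theta>\<^sub>N = \<Sum>\<^sub>n\<^sub>\<le>\<^sub>N \<Sum>\<^sub>j x\<^sub>j ^ (2 * n) / (2 * n)!\<close>, and read \<open>p \<le> q\<close> as \<open>q - p \<in> sos\<close>.  If small perturbations of \<open>p\<close> are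
  sums of squares, then \<open>p\<close> is nonnegative, because at each point the perturbations are dominated by a
  convergent exponential series (\<open>sos_perturbations_imp_nonneg\<close>).  Since \<open>1/(2n)! \<le> 1/n!\<close>, it remains to
  show that a nonnegative \<open>p\<close> satisfies \<open>p + \<epsilon> \<theta>\<^sub>N \<in> sos\<close> for some \<open>N\<close>.  The argument is constructive: it
  uses neither separation of convex cones nor the moment problem.  It has two parts, which deal with
  denominators.

  Existence of denominators (\<open>nonneg_approx_by_sos_quotient\<close>).  Substitute \<open>x\<^sub>j = tan \<theta>\<^sub>j\<close>, which turns \<open>p\<close>
  divided by powers of the \<open>1 + x\<^sub>j\<^sup>2\<close> into a nonnegative trigonometric polynomial, and convolve with a
  positive kernel that is a power of a cosine.  The convolution is a finite average of translates of
  the kernel, with nonnegative weights; even powers of cosines are squares up to powers of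
  \<open>1 + x\<^sub>j\<^sup>2\<close>.  The result is a polynomial \<open>r\<close> with coefficients as close to those of \<open>p\<close> as desired,
  for which \<open>r \<Prod>\<^sub>j (1 + x\<^sub>j\<^sup>2) ^ K\<close> is a sum of squares.

  Removal of denominators (\<open>sos_cancellable_prod\<close>).  It suffices to find \<open>h \<in> sos\<close> such that
  \<open>(1 + x\<^sub>j\<^sup>2) h\<close> is close to \<open>1\<close> in a suitable sense, for one variable at a time.  If a complex polynomial
  \<open>S\<close> in \<open>x\<^sub>j\<close> satisfies \<open>S(-\<i>) = 1\<close>, then \<open>1 - S = (x\<^sub>j + \<i>) g\<close>, so \<open>h = |g|\<^sup>2\<close> will do as soon as
  \<open>w |S|\<^sup>2 \<le> \<delta> \<theta>\<^sub>N\<close> for a certain weight \<open>w\<close>.  Heuristically \<open>S = exp (\<i> t (x\<^sub>j + \<i>))\<close>, of modulus \<open>exp (- t)\<close> on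
  the real line, with large \<open>t\<close>.  A polynomial approximation works only for small \<open>t\<close>, where the
  error is controlled by the factorials in \<open>\<theta>\<^sub>N\<close> (\<open>sos_mult_exp_approx\<close>), but a product of such
  approximations, each accurate enough for the product of the previous ones, contracts geometrically
  (\<open>ex_one_mod_plus_i_contraction\<close>).
\<close>

section \<open>Polynomials as functions\<close>

lemma peval_diff [simp]: "peval (p - q) \<xi> = peval p \<xi> - peval q \<xi>"
proof -
  have "peval (p - q + q) \<xi> = peval (p - q) \<xi> + peval q \<xi>"
    by (rule peval_add)
  then show ?thesis by simp
qed

lemma peval_uminus [simp]: "peval (- p) \<xi> = - peval p \<xi>"
  using peval_diff[of 0 p \<xi>] by simp

lemma peval_prod: "peval (\<Prod>i\<in>I. f i) \<xi> = (\<Prod>i\<in>I. peval (f i) \<xi>)"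
  by (induction I rule: infinite_finite_induct) auto

lemma peval_of_nat [simp]: "peval (of_nat n) \<xi> = of_nat n"
  by (induction n) auto

lemma peval_numeral [simp]: "peval (numeral n) \<xi> = numeral n"
  using peval_of_nat[of "numeral n" \<xi>] by simp

lemma digits_unique:
  fixes f g :: "nat \<Rightarrow> nat"
  assumes "\<And>i. i < d \<Longrightarrow> f i < D" "\<And>i. i < d \<Longrightarrow> g i < D"
    and "(\<Sum>i<d. f i * D ^ i) = (\<Sum>i<d. g i * D ^ i)" "i < d"
  shows "f i = g i"
  using assms
proof (induction d arbitrary: f g i)
  case (Suc d)
  have shift: "(\<Sum>i<Suc d. h i * D ^ i) = h 0 + D * (\<Sum>i<d. h (Suc i) * D ^ i)" for h :: "nat \<Rightarrow> nat"
    by (subst sum.lessThan_Suc_shift) (simp add: sum_distrib_left mult_ac)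
  define F G where "F = (\<Sum>i<d. f (Suc i) * D ^ i)" and "G = (\<Sum>i<d. g (Suc i) * D ^ i)"
  have eq: "f 0 + D * F = g 0 + D * G"
    using Suc.prems(3) unfolding shift F_def G_def .
  have lt: "f 0 < D" "g 0 < D"
    using Suc.prems by auto
  then have "f 0 = (f 0 + D * F) mod D" "g 0 = (g 0 + D * G) mod D"
    by auto
  then have f0: "f 0 = g 0" using eq by simp
  then have "F = G" using eq lt by simp
  then have "f (Suc i) = g (Suc i)" if "i < d" for i
    using Suc.IH[of "\<lambda>i. f (Suc i)" "\<lambda>i. g (Suc i)" i] Suc.prems(1,2) that
    by (simp add: F_def G_def)
  with f0 Suc.prems(4) show ?case by (cases i) auto
qed simp

text \<open>
  A real polynomial is determined by its values.  The Kronecker substitution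
  \<open>x\<^sub>j = t ^ (D ^ index j)\<close>, with \<open>D\<close> larger than every exponent, maps distinct monomials to
  distinct powers of \<open>t\<close> and so reduces the claim to one variable.
\<close>

lemma peval_eq_0_imp_eq_0:
  fixes p :: "('n::finite) rpoly"
  assumes zero: "\<And>\<xi>. peval p \<xi> = 0"
  shows "p = 0"
proof (rule ccontr)
  assume "p \<noteq> 0"
  then obtain m0 where m0: "m0 \<in> Poly_Mapping.keys p" by fastforce
  obtain idx :: "'n \<Rightarrow> nat" where idx: "bij_betw idx UNIV {0..<CARD('n)}"
    using ex_bij_betw_finite_nat[of "UNIV :: 'n set"] by auto
  define K where "K = Poly_Mapping.keys p"
  have "finite ((\<lambda>(m, j). Poly_Mapping.lookup m j) ` (K \<times> (UNIV :: 'n set)))"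
    by (auto simp: K_def)
  then obtain D where D: "\<And>m j. m \<in> K \<Longrightarrow> Poly_Mapping.lookup m j < D"
    unfolding finite_nat_set_iff_bounded by (metis (mono_tags, lifting) SigmaI UNIV_I case_prod_conv imageI)
  define e where "e = (\<lambda>m :: 'n \<Rightarrow>\<^sub>0 nat. \<Sum>j\<in>UNIV. Poly_Mapping.lookup m j * D ^ idx j)"
  have e_inj: "m = m'" if "m \<in> K" "m' \<in> K" "e m = e m'" for m m'
  proof -
    let ?f = "\<lambda>m i. Poly_Mapping.lookup m (inv_into UNIV idx i)"
    have *: "e m = (\<Sum>i<CARD('n). ?f m i * D ^ i)" for m
    proof -
      have "(\<Sum>i<CARD('n). ?f m i * D ^ i) = (\<Sum>j\<in>UNIV. ?f m (idx j) * D ^ idx j)"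
        using sum.reindex_bij_betw[OF idx, of "\<lambda>i. ?f m i * D ^ i"]
        by (simp add: atLeast0LessThan)
      also have "\<dots> = e m"
        using idx by (simp add: e_def bij_betw_def)
      finally show ?thesis ..
    qed
    have "?f m i = ?f m' i" if "i < CARD('n)" for i
      using digits_unique[of "CARD('n)" "?f m" D "?f m'" i] D \<open>m \<in> K\<close> \<open>m' \<in> K\<close> \<open>e m = e m'\<close> that
      by (simp add: *)
    then have "Poly_Mapping.lookup m j = Poly_Mapping.lookup m' j" for j
      using idx bij_betwE[OF idx, rule_format, of j]
      by (metis atLeastLessThan_iff bij_betw_def inv_into_f_f UNIV_I)
    then show ?thesis by (intro poly_mapping_eqI) auto
  qed
  define P where "P = (\<Sum>m\<in>K. Polynomial.monom (Poly_Mapping.lookup p m) (e m))"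
  have "poly P t = peval p (\<chi> j. t ^ (D ^ idx j))" for t
    by (simp add: P_def peval_def K_def poly_sum poly_monom e_def power_sum power_mult[symmetric] mult.commute)
  then have "P = 0" using zero by (simp add: poly_all_0_iff_0 [symmetric])
  then have "0 = coeff P (e m0)" by simp
  also have "\<dots> = (\<Sum>m\<in>K. if m = m0 then Poly_Mapping.lookup p m else 0)"
    unfolding P_def coeff_sum
    by (intro sum.cong) (auto simp: dest: e_inj m0[folded K_def, THEN e_inj[rotated]])
  also have "\<dots> = Poly_Mapping.lookup p m0"
    using m0 by (simp add: K_def)
  finally show False using m0 by (simp add: in_keys_iff)
qed

lemma rpoly_eqI:
  fixes p q :: "('n::finite) rpoly"
  assumes "\<And>\<xi>. peval p \<xi> = peval q \<xi>"
  shows "p = q"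
  using peval_eq_0_imp_eq_0[of "p - q"] assms by simp

section \<open>The cone of sums of squares\<close>

lemma sos_zero [simp]: "0 \<in> sos"
  unfolding sos_def by (auto intro!: exI[of _ 0])

lemma sos_square [intro]: "q\<^sup>2 \<in> sos"
  unfolding sos_def by (auto intro!: exI[of _ 1] exI[of _ "\<lambda>_. q"])

lemma sos_add [intro]:
  assumes "p \<in> sos" "q \<in> sos"
  shows "p + q \<in> sos"
proof -
  obtain k f where p: "p = (\<Sum>l=1..k::nat. (f l)\<^sup>2)" using assms unfolding sos_def by auto
  obtain k' g where q: "q = (\<Sum>l=1..k'::nat. (g l)\<^sup>2)" using assms unfolding sos_def by auto
  define h where "h = (\<lambda>l. if l \<le> k then f l else g (l - k))"
  have "(\<Sum>l=1..k+k'. (h l)\<^sup>2) = (\<Sum>l=1..k. (h l)\<^sup>2) + (\<Sum>l=k+1..k+k'. (h l)\<^sup>2)"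
    by (subst sum.ub_add_nat) auto
  also have "(\<Sum>l=k+1..k+k'. (h l)\<^sup>2) = (\<Sum>l=1..k'. (h (l + k))\<^sup>2)"
    using sum.shift_bounds_cl_nat_ivl[of "\<lambda>l. (h l)\<^sup>2" 1 k k'] by (simp add: add_ac)
  finally have "p + q = (\<Sum>l=1..k+k'. (h l)\<^sup>2)" by (simp add: p q h_def)
  then show ?thesis unfolding sos_def by auto
qed

lemma sos_sum:
  assumes "\<And>i. i \<in> I \<Longrightarrow> f i \<in> sos"
  shows "(\<Sum>i\<in>I. f i) \<in> sos"
  using assms by (induction I rule: infinite_finite_induct) auto

lemma sos_mult [intro]:
  assumes "p \<in> sos" "q \<in> sos"
  shows "p * q \<in> sos"
proof -
  obtain k f where p: "p = (\<Sum>l=1..k::nat. (f l)\<^sup>2)" using assms unfolding sos_def by auto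
  obtain k' g where q: "q = (\<Sum>l=1..k'::nat. (g l)\<^sup>2)" using assms unfolding sos_def by auto
  have "p * q = (\<Sum>l=1..k. \<Sum>l'=1..k'. (f l * g l')\<^sup>2)"
    by (simp add: p q sum_product power_mult_distrib)
  then show ?thesis by (auto intro!: sos_sum)
qed

lemma sos_pconst:
  fixes c :: real
  assumes "c \<ge> 0"
  shows "(pconst c :: ('n::finite) rpoly) \<in> sos"
proof -
  have "(pconst c :: 'n rpoly) = (pconst (sqrt c))\<^sup>2"
    by (rule rpoly_eqI) (simp add: assms)
  then show ?thesis by (metis sos_square)
qed

lemma sos_pconst_mult [intro]:
  "c \<ge> 0 \<Longrightarrow> q \<in> sos \<Longrightarrow> pconst c * (q :: ('n::finite) rpoly) \<in> sos"
  by (intro sos_mult sos_pconst)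

lemma peval_sos_nonneg: "q \<in> sos \<Longrightarrow> peval q \<xi> \<ge> 0"
  unfolding sos_def by (auto simp: peval_sum intro!: sum_nonneg)

section \<open>Polynomials bounded by truncated exponentials\<close>

text \<open>The truncation of \<open>\<Sum>\<^sub>j cosh x\<^sub>j\<close> at degree \<open>2 * N\<close>.\<close>

definition coshsum :: "nat \<Rightarrow> ('n::finite) rpoly" where
  "coshsum N = (\<Sum>n=0..N. \<Sum>j\<in>UNIV. pconst (1 / fact (2 * n)) * pvar j ^ (2 * n))"

lemma sos_even_power: "(q :: 'n rpoly) ^ (2 * n) \<in> sos"
  by (metis mult.commute power_mult sos_square)

lemma coshsum_mono:
  assumes "M \<le> N"
  shows "coshsum N - (coshsum M :: ('n::finite) rpoly) \<in> sos"
proof -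
  have "{0..N} = {0..M} \<union> {M<..N}" using assms by auto
  then have "coshsum N - (coshsum M :: 'n rpoly)
      = (\<Sum>n\<in>{M<..N}. \<Sum>j\<in>UNIV. pconst (1 / fact (2 * n)) * pvar j ^ (2 * n))"
    by (simp add: coshsum_def sum.union_disjoint disjoint_iff)
  then show ?thesis by (auto intro!: sos_sum sos_even_power)
qed

lemma coshsum_sos: "coshsum N \<in> sos"
  unfolding coshsum_def by (auto intro!: sos_sum sos_even_power)

text \<open>Enlarging the coefficient and the degree of the perturbation preserves membership in \<open>sos\<close>.\<close>

lemma sos_coshsum_weaken:
  fixes q :: "('n::finite) rpoly"
  assumes "pconst c * coshsum M + q \<in> sos" "0 \<le> c" "c \<le> d" "M \<le> N"
  shows "pconst d * coshsum N + q \<in> sos"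
proof -
  have "pconst d * coshsum N + q = (pconst c * coshsum M + q)
      + pconst (d - c) * coshsum N + pconst c * (coshsum N - coshsum M)"
    by (rule rpoly_eqI) (simp add: algebra_simps)
  also have "\<dots> \<in> sos"
    by (rule sos_add[OF sos_add[OF assms(1)]])
       (use assms in \<open>auto intro!: sos_pconst_mult coshsum_sos coshsum_mono\<close>)
  finally show ?thesis .
qed

text \<open>
  The polynomials bounded above, modulo \<^const>\<open>sos\<close>, by a multiple of some \<^const>\<open>coshsum\<close>.
  By \<open>ex_coshsum_bound\<close> below this is no restriction.
\<close>

definition coshbounded :: "('n::finite) rpoly \<Rightarrow> bool" where
  "coshbounded q \<longleftrightarrow> (\<exists>C N. C \<ge> 0 \<and> pconst C * coshsum N - q \<in> sos)"

lemma coshbounded_add: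
  fixes p q :: "('n::finite) rpoly"
  assumes "coshbounded p" "coshbounded q"
  shows "coshbounded (p + q)"
proof -
  obtain C M where C: "C \<ge> 0" "pconst C * coshsum M - p \<in> sos" using assms unfolding coshbounded_def by auto
  obtain D N where D: "D \<ge> 0" "pconst D * coshsum N - q \<in> sos" using assms unfolding coshbounded_def by auto
  define K where "K = max M N"
  have "pconst C * coshsum K + (- p) \<in> sos"
    by (rule sos_coshsum_weaken[of C M]) (use C in \<open>simp_all add: K_def\<close>)
  moreover have "pconst D * coshsum K + (- q) \<in> sos"
    by (rule sos_coshsum_weaken[of D N]) (use D in \<open>simp_all add: K_def\<close>)
  ultimately have "(pconst C * coshsum K + (- p)) + (pconst D * coshsum K + (- q)) \<in> sos" by blast
  also have "(pconst C * coshsum K + (- p)) + (pconst D * coshsum K + (- q))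
      = pconst (C + D) * coshsum K - (p + q)"
    by (rule rpoly_eqI) (simp add: algebra_simps)
  finally show ?thesis using C(1) D(1) unfolding coshbounded_def by (metis add_nonneg_nonneg)
qed

lemma coshbounded_pconst_mult:
  fixes p :: "('n::finite) rpoly"
  assumes "coshbounded p" "c \<ge> 0"
  shows "coshbounded (pconst c * p)"
proof -
  obtain C M where C: "C \<ge> 0" "pconst C * coshsum M - p \<in> sos" using assms unfolding coshbounded_def by auto
  have "pconst (c * C) * coshsum M - pconst c * p = pconst c * (pconst C * coshsum M - p)"
    by (rule rpoly_eqI) (simp add: algebra_simps)
  also have "\<dots> \<in> sos" using C assms by blast
  finally show ?thesis using C assms unfolding coshbounded_def by (metis mult_nonneg_nonneg)
qed

lemma coshbounded_le:
  fixes p q :: "('n::finite) rpoly"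
  assumes "coshbounded q" "q - p \<in> sos"
  shows "coshbounded p"
proof -
  obtain C M where C: "C \<ge> 0" "pconst C * coshsum M - q \<in> sos" using assms unfolding coshbounded_def by auto
  have "(pconst C * coshsum M - q) + (q - p) \<in> sos" using C assms by blast
  then show ?thesis using C unfolding coshbounded_def by auto
qed

lemma coshbounded_sum:
  fixes f :: "'i \<Rightarrow> ('n::finite) rpoly"
  assumes "\<And>i. i \<in> I \<Longrightarrow> coshbounded (f i)"
  shows "coshbounded (\<Sum>i\<in>I. f i)"
  using assms
proof (induction I rule: infinite_finite_induct)
  have "coshbounded (0 :: 'n rpoly)" unfolding coshbounded_def
    by (intro exI[of _ 0]) (auto simp: pconst_def)
  { case infinite then show ?case using \<open>coshbounded 0\<close> by simp }
  { case empty then show ?case using \<open>coshbounded 0\<close> by simp }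
qed (auto intro: coshbounded_add)

lemma coshbounded_even_power: "coshbounded (pvar (j :: 'n::finite) ^ (2 * n))"
proof -
  have "pconst (fact (2 * n)) * coshsum n - pvar j ^ (2 * n)
      = pconst (fact (2 * n)) * ((\<Sum>k<n. \<Sum>i\<in>UNIV. pconst (1 / fact (2 * k)) * pvar i ^ (2 * k))
        + (\<Sum>i\<in>UNIV-{j}. pconst (1 / fact (2 * n)) * pvar i ^ (2 * n)))"
  proof (rule rpoly_eqI)
    fix \<xi> :: "real ^ 'n"
    have "(\<Sum>i\<in>UNIV. (1 / fact (2 * n)) * (\<xi> $ i) ^ (2 * n))
       = (1 / fact (2 * n)) * (\<xi> $ j) ^ (2 * n) + (\<Sum>i\<in>UNIV-{j}. (1 / fact (2 * n)) * (\<xi> $ i) ^ (2 * n))"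
      by (subst sum.remove[of _ j]) auto
    moreover have "{0..n} = insert n {..<n}" by auto
    ultimately show "peval (pconst (fact (2 * n)) * coshsum n - pvar j ^ (2 * n)) \<xi>
      = peval (pconst (fact (2 * n)) * ((\<Sum>k<n. \<Sum>i\<in>UNIV. pconst (1 / fact (2 * k)) * pvar i ^ (2 * k))
        + (\<Sum>i\<in>UNIV-{j}. pconst (1 / fact (2 * n)) * pvar i ^ (2 * n)))) \<xi>"
      by (simp add: coshsum_def peval_sum field_simps)
  qed
  also have "\<dots> \<in> sos"
    by (intro sos_pconst_mult sos_add sos_sum sos_even_power) auto
  finally show ?thesis unfolding coshbounded_def by (metis fact_ge_zero)
qed

lemma prod_even_power:
  fixes x :: "'i \<Rightarrow> real"
  shows "(\<Prod>j\<in>J. x j ^ (2 * e j)) = (\<Prod>j\<in>J. x j ^ e j)\<^sup>2"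
  by (simp add: prod_power_distrib power_mult[symmetric] mult.commute)

text \<open>Repeated use of \<open>2uv \<le> u\<^sup>2 + v\<^sup>2\<close> reduces mixed even monomials to even powers of one variable.\<close>

lemma coshbounded_even_monomial:
  fixes e :: "'n::finite \<Rightarrow> nat"
  assumes "finite J"
  shows "coshbounded (\<Prod>j\<in>J. pvar j ^ (2 * e j))"
  using assms
proof (induction J arbitrary: e)
  case empty
  show ?case using coshbounded_even_power[of undefined 0] by simp
next
  case (insert i J)
  let ?u = "pvar i ^ (2 * e i)" and ?v = "\<Prod>j\<in>J. pvar j ^ (2 * e j)"
  have "coshbounded (pconst (1/2) * (pvar i ^ (2 * (2 * e i)) + (\<Prod>j\<in>J. pvar j ^ (2 * (2 * e j)))))"
    by (intro coshbounded_pconst_mult coshbounded_add coshbounded_even_power insert.IH) auto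
  moreover have "pconst (1/2) * (pvar i ^ (2 * (2 * e i)) + (\<Prod>j\<in>J. pvar j ^ (2 * (2 * e j)))) - ?u * ?v
      = pconst (1/2) * (?u - ?v)\<^sup>2"
  proof (rule rpoly_eqI)
    fix \<xi> :: "real ^ 'n"
    have sq: "(\<xi> $ i) ^ (2 * (2 * e i)) = ((\<xi> $ i) ^ (2 * e i))\<^sup>2"
      by (metis mult.commute power_mult)
    show "peval (pconst (1/2) * (pvar i ^ (2 * (2 * e i)) + (\<Prod>j\<in>J. pvar j ^ (2 * (2 * e j)))) - ?u * ?v) \<xi>
      = peval (pconst (1/2) * (?u - ?v)\<^sup>2) \<xi>"
      unfolding peval_diff peval_mult peval_add peval_power peval_prod peval_pconst peval_pvar
        sq prod_even_power[of "\<lambda>j. \<xi> $ j" "\<lambda>j. 2 * e j"]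
      by (simp add: power2_eq_square field_simps)
  qed
  ultimately have "coshbounded (?u * ?v)"
    by (elim coshbounded_le) (auto intro!: sos_pconst_mult)
  then show ?case using insert by simp
qed

lemma coshbounded_monomial:
  fixes e :: "'n::finite \<Rightarrow> nat"
  shows "coshbounded (pconst c * (\<Prod>j\<in>UNIV. pvar j ^ e j))"
proof (rule coshbounded_le)
  let ?v = "\<Prod>j\<in>UNIV. pvar j ^ e j"
  show "coshbounded (pconst (c\<^sup>2 / 2) * (\<Prod>j\<in>{}. pvar j ^ (2 * e j)) + pconst (1/2) * (\<Prod>j\<in>UNIV. pvar j ^ (2 * e j)))"
    by (intro coshbounded_add coshbounded_pconst_mult coshbounded_even_monomial) auto
  have "pconst (c\<^sup>2 / 2) * (\<Prod>j\<in>{}. pvar j ^ (2 * e j)) + pconst (1/2) * (\<Prod>j\<in>UNIV. pvar j ^ (2 * e j)) - pconst c * ?v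
     = pconst (1/2) * (pconst c - ?v)\<^sup>2"
  proof (rule rpoly_eqI)
    fix \<xi> :: "real ^ 'n"
    show "peval (pconst (c\<^sup>2 / 2) * (\<Prod>j\<in>{}. pvar j ^ (2 * e j)) + pconst (1/2) * (\<Prod>j\<in>UNIV. pvar j ^ (2 * e j)) - pconst c * ?v) \<xi>
       = peval (pconst (1/2) * (pconst c - ?v)\<^sup>2) \<xi>"
      unfolding peval_diff peval_mult peval_add peval_power peval_prod peval_pconst peval_pvar
        prod_even_power
      by (simp add: power2_eq_square field_simps)
  qed
  then show "pconst (c\<^sup>2 / 2) * (\<Prod>j\<in>{}. pvar j ^ (2 * e j)) + pconst (1/2) * (\<Prod>j\<in>UNIV. pvar j ^ (2 * e j)) - pconst c * ?v \<in> sos"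
    by auto
qed

lemma rpoly_sum_monomials:
  "(p :: ('n::finite) rpoly) = (\<Sum>m\<in>Poly_Mapping.keys p.
     pconst (Poly_Mapping.lookup p m) * (\<Prod>j\<in>UNIV. pvar j ^ Poly_Mapping.lookup m j))"
  by (rule rpoly_eqI) (simp add: peval_sum peval_prod, simp add: peval_def)

lemma ex_coshsum_bound:
  fixes q :: "('n::finite) rpoly"
  shows "\<exists>C N. C \<ge> 0 \<and> pconst C * coshsum N - q \<in> sos"
proof -
  have "coshbounded q"
    by (subst rpoly_sum_monomials) (intro coshbounded_sum coshbounded_monomial)
  then show ?thesis unfolding coshbounded_def .
qed

section \<open>Inverting \<open>1 + x\<^sub>j\<^sup>2\<close> approximately\<close>

lemma fact_double_le: "(fact (2 * k) :: nat) \<le> 4 ^ k * (fact k)\<^sup>2"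
proof -
  have "(fact (2 * k) :: nat) = fact k * fact k * (2 * k choose k)"
    using binomial_fact_lemma[of k "2 * k"] by simp
  also have "\<dots> \<le> fact k * fact k * 2 ^ (2 * k)"
    by (intro mult_left_mono binomial_le_pow2) auto
  also have "\<dots> = 4 ^ k * (fact k)\<^sup>2"
    by (simp add: power_mult power2_eq_square)
  finally show ?thesis .
qed

lemma fact_quadruple_le: "(fact (4 * k) :: nat) \<le> 256 ^ k * (fact k) ^ 4"
proof -
  have "(fact (4 * k) :: nat) = fact (2 * (2 * k))" by simp
  also have "\<dots> \<le> 4 ^ (2 * k) * (fact (2 * k))\<^sup>2"
    by (rule fact_double_le)
  also have "\<dots> \<le> 4 ^ (2 * k) * (4 ^ k * (fact k)\<^sup>2)\<^sup>2"
    by (intro mult_left_mono power_mono fact_double_le) auto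
  also have "\<dots> = 16 ^ k * (16 ^ k * fact k ^ 4)"
  proof -
    have "(16 :: nat) ^ k = 4 ^ k * 4 ^ k" by (simp flip: power_mult_distrib)
    then show ?thesis by (simp add: power_mult_distrib power_even_eq power4_eq_xxxx power2_eq_square)
  qed
  also have "\<dots> = 256 ^ k * fact k ^ 4"
    by (simp add: mult.assoc[symmetric] power_mult_distrib[symmetric])
  finally show ?thesis .
qed

lemma fact_le_pow_pred:
  assumes "1 \<le> k" "k \<le> n"
  shows "n * fact k \<le> n ^ k"
proof -
  have "fact k \<le> n ^ (k - 1)"
    using assms
  proof (induction k rule: dec_induct)
    case (step k)
    then have "Suc k * fact k \<le> n * n ^ (k - 1)" by (intro mult_mono) auto
    with step show ?case by (cases k) auto
  qed simp
  then have "n * fact k \<le> n * n ^ (k - 1)" by simp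
  then show ?thesis using assms by (cases k) auto
qed

lemma binomial_coeff_square_bound:
  assumes "1 \<le> k" "k \<le> n"
  shows "(real (n choose k) * (1 / (4 * real n))\<^sup>2 ^ k)\<^sup>2 \<le> 1 / ((real n)\<^sup>2 * fact (4 * k))"
proof -
  have n: "real n > 0" using assms by simp
  have "real ((n choose k) * fact k) \<le> real (n ^ k)"
    using binomial_fact_pow[of n k] by (simp only: of_nat_le_iff)
  then have b: "real (n choose k) \<le> real n ^ k / fact k" by (simp add: field_simps)
  have "real (n * fact k) \<le> real (n ^ k)"
    using fact_le_pow_pred[OF assms] by (simp only: of_nat_le_iff)
  then have f: "real n * fact k \<le> real n ^ k" by simp
  have "real (n choose k) * (1 / (4 * real n))\<^sup>2 ^ k
      = real (n choose k) / (16 ^ k * real n ^ k * real n ^ k)"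
    by (simp add: power2_eq_square power_mult_distrib power_divide)
  also have "\<dots> \<le> (real n ^ k / fact k) / (16 ^ k * real n ^ k * real n ^ k)"
    using b n by (intro divide_right_mono) auto
  also have "\<dots> = 1 / (16 ^ k * fact k * real n ^ k)"
    using n by (simp add: field_simps)
  also have "\<dots> \<le> 1 / (16 ^ k * fact k * (real n * fact k))"
    using f n by (intro divide_left_mono mult_left_mono mult_pos_pos) auto
  finally have "(real (n choose k) * (1 / (4 * real n))\<^sup>2 ^ k)\<^sup>2
      \<le> (1 / (16 ^ k * fact k * (real n * fact k)))\<^sup>2"
    by (intro power_mono) auto
  also have "\<dots> = 1 / ((real n)\<^sup>2 * (256 ^ k * fact k ^ 4))"
  proof -
    have "(256 :: real) ^ k = 16 ^ k * 16 ^ k" by (simp flip: power_mult_distrib)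
    then show ?thesis by (simp add: power_divide power_mult_distrib power4_eq_xxxx power2_eq_square mult_ac)
  qed
  also have "\<dots> \<le> 1 / ((real n)\<^sup>2 * fact (4 * k))"
  proof (intro divide_left_mono mult_left_mono mult_pos_pos)
    have "real (fact (4 * k)) \<le> real (256 ^ k * fact k ^ 4)"
      using fact_quadruple_le[of k] by (simp only: of_nat_le_iff)
    then show "fact (4 * k) \<le> 256 ^ k * (fact k ^ 4 :: real)" by simp
  qed (use n in auto)
  finally show ?thesis .
qed

text \<open>
  The factor \<open>F = (1 + (x\<^sub>j/(4n))\<^sup>2) ^ n\<close> is the squared modulus of \<open>(1 + \<i> x\<^sub>j/(4n)) ^ n\<close>, an approximation
  of \<open>exp (\<i> x\<^sub>j/4)\<close>, and \<open>w F\<close> exceeds \<open>w\<close> only by a small error.  Indeed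
  \<open>b w x\<^sub>j ^ (2 * k) \<le> \<mu> w\<^sup>2 + b\<^sup>2/(4\<mu>) x\<^sub>j ^ (4 * k)\<close>, where \<open>b\<close> is the coefficient of \<open>x\<^sub>j ^ (2 * k)\<close> in \<open>F\<close>,
  \<open>k \<ge> 1\<close>.  The growth of the factorials enters through \<open>b\<^sup>2 \<le> 1/(n\<^sup>2 (4k)!)\<close>; the scaling by \<open>1/4\<close>
  compensates the factor \<open>256 ^ k\<close> in \<open>fact_quadruple_le\<close>.
\<close>

lemma sos_mult_exp_approx:
  fixes w :: "('n::finite) rpoly"
  assumes "\<delta> > 0"
  shows "\<exists>n N. n \<ge> 1 \<and> w + pconst \<delta> * coshsum N
           - w * (1 + pconst ((1 / (4 * real n))\<^sup>2) * pvar j ^ 2) ^ n \<in> sos"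
proof -
  obtain C M where C: "C \<ge> 0" and CM: "pconst C * coshsum M - w\<^sup>2 \<in> sos"
    using ex_coshsum_bound[of "w\<^sup>2"] by auto
  define \<eta> where "\<eta> = \<delta> / (2 * (C + 1))"
  have \<eta>: "\<eta> > 0" "\<eta> * C \<le> \<delta> / 2"
    using C assms by (auto simp: \<eta>_def field_simps)
  obtain n :: nat where n: "real n > 1 / (2 * \<eta> * \<delta>) + 1"
    using reals_Archimedean2 by blast
  then have n1: "real n > 1 / (2 * \<eta> * \<delta>)" "real n > 1"
    using \<eta> assms by (smt (verit) divide_pos_pos mult_pos_pos)+
  then have n2: "1 / (4 * \<eta> * real n) \<le> \<delta> / 2" "n \<ge> 1"
    using \<eta> assms by (auto simp: field_simps)
  define b where "b k = real (n choose k) * (1 / (4 * real n))\<^sup>2 ^ k" for k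
  \<comment> \<open>the \<open>n\<close> multiples of \<open>w\<^sup>2\<close> add up to \<open>\<eta> w\<^sup>2\<close>\<close>
  define \<mu> where "\<mu> = \<eta> / real n"
  have \<mu>: "\<mu> > 0" using \<eta> n2 by (simp add: \<mu>_def)
  define x :: "'n rpoly" where "x = pvar j"
  define N where "N = max M (2 * n)"
  \<comment> \<open>the square completing \<open>b w x ^ (2 * k)\<close>\<close>
  define sq where "sq k = (pconst (sqrt \<mu>) * w - pconst (b k / (2 * sqrt \<mu>)) * x ^ (2 * k))\<^sup>2" for k
  define c where "c k = 1 / (4 * \<eta> * real n * fact (4 * k)) - (b k / (2 * sqrt \<mu>))\<^sup>2" for k
  have c: "c k \<ge> 0" if "k \<in> {1..n}" for k
  proof -
    have "(b k / (2 * sqrt \<mu>))\<^sup>2 = (b k)\<^sup>2 / (4 * \<mu>)"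
      using \<mu> by (simp add: power_divide power_mult_distrib)
    also have "\<dots> \<le> (1 / ((real n)\<^sup>2 * fact (4 * k))) / (4 * \<mu>)"
      using binomial_coeff_square_bound[of k n] that \<mu>
      by (intro divide_right_mono) (auto simp: b_def)
    also have "\<dots> = 1 / (4 * \<eta> * real n * fact (4 * k))"
      using \<eta> n2 by (simp add: \<mu>_def power2_eq_square field_simps)
    finally show ?thesis by (simp add: c_def)
  qed
  have expand: "(1 + pconst ((1 / (4 * real n))\<^sup>2) * x ^ 2) ^ n = 1 + (\<Sum>k=1..n. pconst (b k) * x ^ (2 * k))"
  proof (rule rpoly_eqI)
    fix \<xi> :: "real ^ 'n"
    let ?t = "(1 / (4 * real n))\<^sup>2" and ?X = "peval x \<xi>"
    have "(1 + ?t * ?X\<^sup>2) ^ n = (\<Sum>k\<le>n. b k * ?X ^ (2 * k))"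
      by (subst add.commute, subst binomial_ring)
         (simp add: b_def power_mult_distrib power_mult[symmetric] mult_ac)
    also have "\<dots> = 1 + (\<Sum>k=1..n. b k * ?X ^ (2 * k))"
      by (subst atMost_atLeast0, subst sum.atLeast_Suc_atMost) (auto simp: b_def)
    finally show "peval ((1 + pconst ?t * x ^ 2) ^ n) \<xi> = peval (1 + (\<Sum>k=1..n. pconst (b k) * x ^ (2 * k))) \<xi>"
      by (simp add: peval_sum)
  qed
  define P1 where "P1 = (\<Sum>k=1..n. sq k)"
  define P2 where "P2 = (\<Sum>k=1..n. pconst (c k) * x ^ (2 * (2 * k)))"
  define P3 where "P3 = (\<Sum>k=1..n. pconst (b k) * x ^ (2 * k))"
  define P4 where "P4 = (\<Sum>k=1..n. pconst (1 / fact (4 * k)) * x ^ (2 * (2 * k)))"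
  have "w + pconst \<delta> * coshsum N - w * (1 + P3)
     = P1 + P2 + pconst \<eta> * (pconst C * coshsum M - w\<^sup>2)
       + (pconst (\<delta> / 2) * coshsum N + pconst (- \<eta> * C) * coshsum M)
       + (pconst (\<delta> / 2) * coshsum N + pconst (- 1 / (4 * \<eta> * real n)) * P4)"
  proof (rule rpoly_eqI)
    fix \<xi> :: "real ^ 'n"
    let ?w = "peval w \<xi>" and ?X = "peval x \<xi>"
    have sqk: "peval (sq k) \<xi> = \<mu> * ?w\<^sup>2 - b k * ?w * ?X ^ (2 * k) + (b k / (2 * sqrt \<mu>))\<^sup>2 * ?X ^ (2 * (2 * k))" for k
    proof -
      have "?X ^ (2 * (2 * k)) = ?X ^ (2 * k) * ?X ^ (2 * k)"
        by (simp flip: power_add)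
      moreover have "sqrt \<mu> * sqrt \<mu> = \<mu>" "sqrt \<mu> \<noteq> 0" using \<mu> by auto
      ultimately show ?thesis
        by (simp add: sq_def power2_eq_square field_simps)
    qed
    have "peval P1 \<xi> + peval P2 \<xi>
       = (\<Sum>k=1..n. \<mu> * ?w\<^sup>2 - ?w * (b k * ?X ^ (2 * k)) + 1 / (4 * \<eta> * real n) * (1 / fact (4 * k) * ?X ^ (2 * (2 * k))))"
      unfolding P1_def P2_def peval_sum sum.distrib[symmetric]
      by (rule sum.cong) (simp_all add: sqk c_def algebra_simps)
    also have "\<dots> = \<eta> * ?w\<^sup>2 - ?w * peval P3 \<xi> + 1 / (4 * \<eta> * real n) * peval P4 \<xi>"
      unfolding P3_def P4_def peval_sum sum.distrib sum_subtractf sum_distrib_left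
      using n2 by (simp add: \<mu>_def)
    finally show "peval (w + pconst \<delta> * coshsum N - w * (1 + P3)) \<xi>
     = peval (P1 + P2 + pconst \<eta> * (pconst C * coshsum M - w\<^sup>2)
       + (pconst (\<delta> / 2) * coshsum N + pconst (- \<eta> * C) * coshsum M)
       + (pconst (\<delta> / 2) * coshsum N + pconst (- 1 / (4 * \<eta> * real n)) * P4)) \<xi>"
      by (simp add: algebra_simps)
  qed
  also have "\<dots> \<in> sos"
  proof (rule sos_add[OF sos_add[OF sos_add[OF sos_add]]])
    show "P1 \<in> sos" unfolding P1_def sq_def by (intro sos_sum sos_square)
    show "P2 \<in> sos" unfolding P2_def
      by (intro sos_sum sos_pconst_mult sos_even_power c)
    show "pconst \<eta> * (pconst C * coshsum M - w\<^sup>2) \<in> sos"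
      using CM \<eta> by (intro sos_pconst_mult) auto
    have cancel: "pconst (\<eta> * C) * coshsum M + pconst (- (\<eta> * C)) * coshsum M = (0 :: 'n rpoly)"
      by (rule rpoly_eqI) simp
    show "pconst (\<delta> / 2) * coshsum N + pconst (- \<eta> * C) * coshsum M \<in> (sos :: 'n rpoly set)"
      by (rule sos_coshsum_weaken[where c = "\<eta> * C" and M = M])
         (use \<eta> C in \<open>auto simp: N_def cancel\<close>)
    have "coshsum (2 * n) - P4 \<in> sos"
    proof -
      define g :: "nat \<Rightarrow> 'n rpoly" where "g l = pconst (1 / fact (2 * l)) * x ^ (2 * l)" for l
      define h :: "nat \<Rightarrow> 'n rpoly" where "h l = (\<Sum>i\<in>UNIV-{j}. pconst (1 / fact (2 * l)) * pvar i ^ (2 * l))" for l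
      let ?E = "(\<lambda>k. 2 * k) ` {1..n}"
      have sub: "?E \<subseteq> {0..2*n}" by auto
      have S: "P4 = (\<Sum>l\<in>?E. g l)"
        unfolding P4_def by (subst sum.reindex) (auto simp: g_def inj_on_def intro!: sum.cong)
      have "coshsum (2 * n) = (\<Sum>l=0..2*n. g l + h l)"
        unfolding coshsum_def g_def h_def x_def
        by (rule sum.cong[OF refl], subst sum.remove[of _ j]) auto
      also have "\<dots> = (\<Sum>l\<in>?E. g l) + (\<Sum>l\<in>{0..2*n}-?E. g l) + (\<Sum>l=0..2*n. h l)"
        using sum.subset_diff[OF sub, of g] by (simp add: sum.distrib add_ac)
      finally have "coshsum (2 * n) - P4 = (\<Sum>l\<in>{0..2*n}-?E. g l) + (\<Sum>l=0..2*n. h l)"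
        by (simp add: S)
      then show ?thesis
        by (auto simp: g_def h_def intro!: sos_sum sos_pconst_mult sos_even_power)
    qed
    then have "pconst (1 / (4 * \<eta> * real n)) * (coshsum (2 * n) - P4) \<in> sos"
      using \<eta> by (intro sos_pconst_mult) auto
    also have "pconst (1 / (4 * \<eta> * real n)) * (coshsum (2 * n) - P4)
       = pconst (1 / (4 * \<eta> * real n)) * coshsum (2 * n) + pconst (- 1 / (4 * \<eta> * real n)) * P4"
      by (rule rpoly_eqI) (simp add: algebra_simps)
    finally have bound: "\<dots> \<in> sos" .
    show "pconst (\<delta> / 2) * coshsum N + pconst (- 1 / (4 * \<eta> * real n)) * P4 \<in> sos"
      by (rule sos_coshsum_weaken[OF bound]) (use \<eta> n2 in \<open>auto simp: N_def\<close>)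
  qed
  finally have "w + pconst \<delta> * coshsum N
      - w * (1 + pconst ((1 / (4 * real n))\<^sup>2) * x ^ 2) ^ n \<in> sos"
    by (simp only: expand P3_def)
  then show ?thesis using n2 unfolding x_def by blast
qed

text \<open>
  The complex polynomial \<open>S = A + \<i> B\<close>, with real \<open>A\<close> and \<open>B\<close>, is congruent to \<open>1\<close> modulo \<open>x\<^sub>j + \<i>\<close>:
  \<open>1 - S = (x\<^sub>j + \<i>)(a + \<i> b)\<close> for some real polynomials \<open>a\<close> and \<open>b\<close>.  The defining equations are the
  real and imaginary parts of this identity.
\<close>

definition one_mod_plus_i :: "'n \<Rightarrow> ('n::finite) rpoly \<Rightarrow> 'n rpoly \<Rightarrow> bool" where
  "one_mod_plus_i j A B \<longleftrightarrow> (\<exists>a b. 1 - A = pvar j * a - b \<and> - B = a + pvar j * b)"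

lemma one_mod_plus_i_1: "one_mod_plus_i j 1 0"
  unfolding one_mod_plus_i_def by (auto intro!: exI[of _ 0])

lemma one_mod_plus_i_mult:
  assumes "one_mod_plus_i j A B" "one_mod_plus_i j A' B'"
  shows "one_mod_plus_i j (A * A' - B * B') (A * B' + B * A')"
proof -
  obtain a b where 1: "1 - A = pvar j * a - b" "- B = a + pvar j * b"
    using assms unfolding one_mod_plus_i_def by auto
  obtain a' b' where 2: "1 - A' = pvar j * a' - b'" "- B' = a' + pvar j * b'"
    using assms unfolding one_mod_plus_i_def by auto
  have A: "A = 1 - (pvar j * a - b)" and B: "B = - (a + pvar j * b)"
    by (simp_all flip: 1)
  have A': "A' = 1 - (pvar j * a' - b')" and B': "B' = - (a' + pvar j * b')"
    by (simp_all flip: 2)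
  show ?thesis unfolding one_mod_plus_i_def
  proof (intro exI conjI)
    show "1 - (A * A' - B * B') = pvar j * (a + (A * a' - B * b')) - (b + (A * b' + B * a'))"
      unfolding A' B' by (simp add: A B algebra_simps)
    show "- (A * B' + B * A') = (a + (A * a' - B * b')) + pvar j * (b + (A * b' + B * a'))"
      unfolding A' B' by (simp add: A B algebra_simps)
  qed
qed

text \<open>The witness is \<open>((1 + \<i> t x\<^sub>j)/(1 + t)) ^ n\<close>, which takes the value \<open>1\<close> at \<open>x\<^sub>j = - \<i>\<close>.\<close>

lemma one_mod_plus_i_power:
  fixes j :: "'n::finite"
  assumes "t \<ge> 0"
  shows "\<exists>A B. one_mod_plus_i j A B \<and> A\<^sup>2 + B\<^sup>2 = pconst (1 / (1 + t) ^ (2 * n)) * (1 + pconst (t\<^sup>2) * pvar j ^ 2) ^ n"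
proof (induction n)
  case 0
  have "pconst 1 = (1 :: 'n rpoly)" by (rule rpoly_eqI) simp
  then show ?case using one_mod_plus_i_1 by (intro exI[of _ 1] exI[of _ 0]) auto
next
  case (Suc n)
  then obtain A B where AB: "one_mod_plus_i j A B"
    "A\<^sup>2 + B\<^sup>2 = pconst (1 / (1 + t) ^ (2 * n)) * (1 + pconst (t\<^sup>2) * pvar j ^ 2) ^ n" by blast
  let ?A = "pconst (1 / (1 + t)) :: 'n rpoly" and ?B = "pconst (t / (1 + t)) * pvar j"
  have "one_mod_plus_i j ?A ?B"
    unfolding one_mod_plus_i_def
    by (intro exI[of _ 0] exI[of _ "pconst (- t / (1 + t))"] conjI; rule rpoly_eqI)
       (use assms in \<open>auto simp: field_simps\<close>)
  then have "one_mod_plus_i j (A * ?A - B * ?B) (A * ?B + B * ?A)"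
    using AB by (intro one_mod_plus_i_mult)
  moreover have "(A * ?A - B * ?B)\<^sup>2 + (A * ?B + B * ?A)\<^sup>2 = (A\<^sup>2 + B\<^sup>2) * (?A\<^sup>2 + ?B\<^sup>2)"
    by (simp add: power2_eq_square algebra_simps)
  moreover have "?A\<^sup>2 + ?B\<^sup>2 = pconst (1 / (1 + t) ^ 2) * (1 + pconst (t\<^sup>2) * pvar j ^ 2)"
    by (rule rpoly_eqI) (simp add: field_simps power_mult_distrib power_divide)
  moreover have "(pconst (1 / (1 + t) ^ (2 * n)) * (1 + pconst (t\<^sup>2) * pvar j ^ 2) ^ n)
      * (pconst (1 / (1 + t) ^ 2) * (1 + pconst (t\<^sup>2) * pvar j ^ 2))
      = pconst (1 / (1 + t) ^ (2 * Suc n)) * (1 + pconst (t\<^sup>2) * pvar j ^ 2 :: 'n rpoly) ^ Suc n"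
    by (rule rpoly_eqI) (simp add: power2_eq_square mult_ac)
  ultimately show ?case
    by (intro exI[of _ "A * ?A - B * ?B"] exI[of _ "A * ?B + B * ?A"]) (simp only: AB simp_thms)
qed

text \<open>
  The witness is a product of \<open>m\<close> of the polynomials \<open>((1 + \<i> t x\<^sub>j)/(1 + t)) ^ n\<close> with \<open>t = 1/(4n)\<close>.  In
  each factor the numerator does not increase \<open>w\<close> noticeably, while the denominator satisfies
  \<open>(1 + t) ^ n \<ge> 5/4\<close>; this gives the contraction by \<open>(4/5)\<^sup>2 = 16/25\<close>.  The exponents \<open>n\<close> are
  chosen one after the other, each depending on the product of the earlier factors.
\<close>

lemma ex_one_mod_plus_i_contraction:
  fixes w :: "('n::finite) rpoly"
  assumes w: "w \<in> sos" and "\<delta> > 0"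
  shows "\<exists>A B N. one_mod_plus_i j A B \<and>
    pconst ((16 / 25) ^ m) * w + pconst \<delta> * coshsum N - w * (A\<^sup>2 + B\<^sup>2) \<in> sos"
  using \<open>\<delta> > 0\<close>
proof (induction m arbitrary: \<delta>)
  case 0
  have "pconst ((16 / 25) ^ 0) * w + pconst \<delta> * coshsum 0 - w * (1\<^sup>2 + 0\<^sup>2) = pconst \<delta> * coshsum 0"
    by (rule rpoly_eqI) simp
  also have "\<dots> \<in> sos" using 0 coshsum_sos by (intro sos_pconst_mult) auto
  finally show ?case using one_mod_plus_i_1 by blast
next
  case (Suc m)
  define \<rho> :: real where "\<rho> = 16 / 25"
  obtain A B M where AB: "one_mod_plus_i j A B"
    and M: "pconst (\<rho> ^ m) * w + pconst (\<delta> / 2) * coshsum M - w * (A\<^sup>2 + B\<^sup>2) \<in> sos"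
    using Suc.IH[of "\<delta> / 2"] Suc.prems unfolding \<rho>_def by auto
  define w' where "w' = w * (A\<^sup>2 + B\<^sup>2)"
  have w': "w' \<in> sos" using w by (auto simp: w'_def)
  obtain n L where n: "n \<ge> 1" and L: "w' + pconst (\<delta> / 2) * coshsum L
      - w' * (1 + pconst ((1 / (4 * real n))\<^sup>2) * pvar j ^ 2) ^ n \<in> sos"
    using sos_mult_exp_approx[of "\<delta> / 2" w' j] Suc.prems by auto
  define F where "F = (1 + pconst ((1 / (4 * real n))\<^sup>2) * pvar j ^ 2) ^ n"
  define \<kappa> where "\<kappa> = 1 / (1 + 1 / (4 * real n)) ^ (2 * n)"
  obtain A' B' where AB': "one_mod_plus_i j A' B'" "A'\<^sup>2 + B'\<^sup>2 = pconst \<kappa> * F"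
    using one_mod_plus_i_power[of "1 / (4 * real n)" j n] by (auto simp: \<kappa>_def F_def)
  have "5 / 4 \<le> (1 + 1 / (4 * real n)) ^ n"
  proof -
    have "5 / 4 = 1 + real n * (1 / (4 * real n))" using n by (simp add: field_simps)
    also have "\<dots> \<le> (1 + 1 / (4 * real n)) ^ n"
      by (rule Bernoulli_inequality) (smt (verit) divide_nonneg_nonneg of_nat_0_le_iff)
    finally show ?thesis .
  qed
  then have "(5 / 4)\<^sup>2 \<le> ((1 + 1 / (4 * real n)) ^ n)\<^sup>2"
    by (intro power_mono) auto
  then have "1 / \<rho> \<le> (1 + 1 / (4 * real n)) ^ (2 * n)"
    by (simp add: \<rho>_def power_even_eq power2_eq_square)
  then have \<kappa>: "0 \<le> \<kappa>" "\<kappa> \<le> \<rho>"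
    unfolding \<kappa>_def by (auto simp: \<rho>_def field_simps)
  define N where "N = max M L"
  have "pconst (\<rho> ^ Suc m) * w + pconst \<delta> * coshsum N - w' * (pconst \<kappa> * F)
     = pconst \<rho> * (pconst (\<rho> ^ m) * w + pconst (\<delta> / 2) * coshsum M - w')
      + pconst (\<rho> - \<kappa>) * w' + pconst \<kappa> * (w' + pconst (\<delta> / 2) * coshsum L - w' * F)
      + pconst (\<delta> / 2) * (coshsum N - coshsum M) + pconst ((1 - \<rho>) * \<delta> / 2) * coshsum M
      + pconst (\<delta> / 2) * (coshsum N - coshsum L) + pconst ((1 - \<kappa>) * \<delta> / 2) * coshsum L"
    by (rule rpoly_eqI) (simp add: field_simps)
  also have "\<dots> \<in> sos"
    using M[folded w'_def] L[folded F_def] w' \<kappa> Suc.prems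
    by (intro sos_add sos_pconst_mult coshsum_sos coshsum_mono) (auto simp: \<rho>_def N_def)
  also have "w' * (pconst \<kappa> * F) = w * ((A * A' - B * B')\<^sup>2 + (A * B' + B * A')\<^sup>2)"
    unfolding AB'(2)[symmetric] w'_def by (simp add: power2_eq_square algebra_simps)
  finally show ?case
    using one_mod_plus_i_mult[OF AB AB'(1)] unfolding \<rho>_def by blast
qed

lemma ex_one_mod_plus_i_small:
  fixes w :: "('n::finite) rpoly"
  assumes w: "w \<in> sos" and "\<delta> > 0"
  shows "\<exists>A B N. one_mod_plus_i j A B \<and> pconst \<delta> * coshsum N - w * (A\<^sup>2 + B\<^sup>2) \<in> sos"
proof -
  obtain C M where C: "C \<ge> 0" and M: "pconst C * coshsum M - w \<in> sos"
    using ex_coshsum_bound[of w] by auto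
  have "\<delta> / 2 / (C + 1) > 0" using C \<open>\<delta> > 0\<close> by simp
  then obtain m where "(16 / 25 :: real) ^ m < \<delta> / 2 / (C + 1)"
    using real_arch_pow_inv[of "\<delta> / 2 / (C + 1)" "16 / 25"] by auto
  then have m: "(16 / 25 :: real) ^ m * C \<le> \<delta> / 2"
    using C by (simp add: field_simps) (smt (verit) zero_less_power)
  obtain A B L where AB: "one_mod_plus_i j A B"
    and L: "pconst ((16 / 25) ^ m) * w + pconst (\<delta> / 2) * coshsum L - w * (A\<^sup>2 + B\<^sup>2) \<in> sos"
    using ex_one_mod_plus_i_contraction[OF w, of "\<delta> / 2" j m] \<open>\<delta> > 0\<close> by auto
  define N where "N = max M L"
  have "pconst \<delta> * coshsum N - w * (A\<^sup>2 + B\<^sup>2)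
     = (pconst ((16 / 25) ^ m) * w + pconst (\<delta> / 2) * coshsum L - w * (A\<^sup>2 + B\<^sup>2))
      + pconst ((16 / 25) ^ m) * (pconst C * coshsum M - w)
      + pconst (\<delta> / 2 - (16 / 25) ^ m * C) * coshsum M
      + pconst (\<delta> / 2) * (coshsum N - coshsum M) + pconst (\<delta> / 2) * (coshsum N - coshsum L)"
    by (rule rpoly_eqI) (simp add: field_simps)
  also have "\<dots> \<in> sos"
    using m \<open>\<delta> > 0\<close>
    by (intro sos_add[OF sos_add[OF sos_add[OF sos_add[OF L sos_pconst_mult[OF _ M]]]]]
          sos_pconst_mult coshsum_sos coshsum_mono) (auto simp: N_def)
  finally show ?thesis using AB by blast
qed

text \<open>
  Division by \<open>D\<close> within \<^const>\<open>sos\<close>, up to small perturbations: for every \<open>q\<close> there are \<open>h \<in> sos\<close>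
  such that \<open>q\<close> is bounded below by \<open>q D h\<close> minus a small error.  If \<open>q D\<close> is a sum of squares,
  then so is \<open>q D h\<close>, and hence so is \<open>q\<close> after a small perturbation.
\<close>

definition sos_cancellable :: "('n::finite) rpoly \<Rightarrow> bool" where
  "sos_cancellable D \<longleftrightarrow> (\<forall>q. \<forall>\<delta>>0. \<exists>h\<in>sos. \<exists>N. q + pconst \<delta> * coshsum N - q * D * h \<in> sos)"

text \<open>
  If \<open>1 - S = (x\<^sub>j + \<i>)(a + \<i> b)\<close> and \<open>h = a\<^sup>2 + b\<^sup>2\<close>, then \<open>(1 + x\<^sub>j\<^sup>2) h = |1 - S|\<^sup>2\<close>, which is close
  to \<open>1\<close> if \<open>|S|\<^sup>2\<close> is small.  Smallness is needed only relative to the weight \<open>w\<close> in the proof,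
  which absorbs the cross term \<open>2 q A\<close> and the term \<open>q |S|\<^sup>2\<close>.
\<close>

lemma sos_cancellable_one_plus_square:
  fixes j :: "'n::finite"
  shows "sos_cancellable (1 + pvar j ^ 2)"
  unfolding sos_cancellable_def
proof (intro allI impI)
  fix q :: "'n rpoly" and \<delta> :: real assume "\<delta> > 0"
  obtain C M where C: "C \<ge> 0" and M: "pconst C * coshsum M - q\<^sup>2 \<in> sos"
    using ex_coshsum_bound[of "q\<^sup>2"] by auto
  define \<eta> where "\<eta> = \<delta> / (2 * (C + 1))"
  have \<eta>: "\<eta> > 0" "\<eta> * C \<le> \<delta> / 2"
    using C \<open>\<delta> > 0\<close> by (auto simp: \<eta>_def field_simps)
  define w where "w = pconst (1 / \<eta>) + pconst (1 / 2) * (1\<^sup>2 + q\<^sup>2)"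
  have w: "w \<in> sos"
    using \<eta> unfolding w_def by (intro sos_add sos_pconst_mult sos_pconst sos_square) auto
  obtain A B L where AB: "one_mod_plus_i j A B" and L: "pconst (\<delta> / 2) * coshsum L - w * (A\<^sup>2 + B\<^sup>2) \<in> sos"
    using ex_one_mod_plus_i_small[OF w, of "\<delta> / 2" j] \<open>\<delta> > 0\<close> by auto
  obtain a b where ab: "1 - A = pvar j * a - b" "- B = a + pvar j * b"
    using AB unfolding one_mod_plus_i_def by auto
  define N where "N = max M L"
  have "(1 + pvar j ^ 2) * (a\<^sup>2 + b\<^sup>2) = (pvar j * a - b)\<^sup>2 + (a + pvar j * b)\<^sup>2"
    by (simp add: power2_eq_square algebra_simps)
  then have h: "(1 + pvar j ^ 2) * (a\<^sup>2 + b\<^sup>2) = (1 - A)\<^sup>2 + B\<^sup>2"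
    by (simp flip: ab)
  define s where "s = (pconst (sqrt \<eta>) * q + pconst (1 / sqrt \<eta>) * A)\<^sup>2"
  have "q + pconst \<delta> * coshsum N - q * ((1 - A)\<^sup>2 + B\<^sup>2)
     = s + pconst (1 / \<eta>) * B\<^sup>2
      + pconst (1 / 2) * ((1 - q)\<^sup>2 * (A\<^sup>2 + B\<^sup>2))
      + (pconst (\<delta> / 2) * coshsum L - w * (A\<^sup>2 + B\<^sup>2))
      + pconst \<eta> * (pconst C * coshsum M - q\<^sup>2) + pconst (\<delta> / 2 - \<eta> * C) * coshsum M
      + pconst (\<delta> / 2) * (coshsum N - coshsum M) + pconst (\<delta> / 2) * (coshsum N - coshsum L)"
    (is "_ = s + ?s2 + ?s3 + ?s4 + ?s5 + ?s6 + ?s7 + ?s8")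
  proof (rule rpoly_eqI)
    fix \<xi> :: "real ^ 'n"
    have "sqrt \<eta> * sqrt \<eta> = \<eta>" "sqrt \<eta> > 0" using \<eta> by auto
    then have "peval s \<xi> = \<eta> * (peval q \<xi>)\<^sup>2 + 2 * peval q \<xi> * peval A \<xi> + 1 / \<eta> * (peval A \<xi>)\<^sup>2"
      by (simp add: s_def power2_eq_square field_simps)
    then show "peval (q + pconst \<delta> * coshsum N - q * ((1 - A)\<^sup>2 + B\<^sup>2)) \<xi>
        = peval (s + ?s2 + ?s3 + ?s4 + ?s5 + ?s6 + ?s7 + ?s8) \<xi>"
      unfolding w_def by (simp add: power2_eq_square algebra_simps add_divide_distrib diff_divide_distrib)
  qed
  also have "\<dots> \<in> sos"
  proof -
    have "s \<in> sos" "?s2 \<in> sos" "?s3 \<in> sos"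
      using \<eta> unfolding s_def by (auto intro!: sos_pconst_mult)
    moreover have "?s4 \<in> sos" by (rule L)
    moreover have "?s5 \<in> sos" using M \<eta> by (auto intro!: sos_pconst_mult)
    moreover have "?s6 \<in> sos" "?s7 \<in> sos" "?s8 \<in> sos"
      using \<eta> \<open>\<delta> > 0\<close> by (auto intro!: sos_pconst_mult coshsum_sos coshsum_mono simp: N_def)
    ultimately show ?thesis by (intro sos_add)
  qed
  finally have "q + pconst \<delta> * coshsum N - q * (1 + pvar j ^ 2) * (a\<^sup>2 + b\<^sup>2) \<in> sos"
    by (simp add: h mult.assoc)
  then show "\<exists>h\<in>sos. \<exists>N. q + pconst \<delta> * coshsum N - q * (1 + pvar j ^ 2) * h \<in> sos"
    by (intro bexI[of _ "a\<^sup>2 + b\<^sup>2"]) auto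
qed

lemma sos_cancellable_1: "sos_cancellable (1 :: ('n::finite) rpoly)"
  unfolding sos_cancellable_def
proof (intro allI impI)
  fix q :: "'n rpoly" and \<delta> :: real assume "\<delta> > 0"
  then have "pconst \<delta> * coshsum 0 \<in> (sos :: 'n rpoly set)" by (intro sos_pconst_mult coshsum_sos) auto
  moreover have "1 \<in> (sos :: 'n rpoly set)" using sos_square[of 1] by simp
  ultimately show "\<exists>h\<in>sos. \<exists>N. q + pconst \<delta> * coshsum N - q * 1 * h \<in> sos"
    by (intro bexI[of _ 1] exI[of _ 0]) auto
qed

lemma sos_cancellable_mult:
  fixes D E :: "('n::finite) rpoly"
  assumes "sos_cancellable D" "sos_cancellable E"
  shows "sos_cancellable (D * E)"
  unfolding sos_cancellable_def
proof (intro allI impI)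
  fix q :: "'n rpoly" and \<delta> :: real assume "\<delta> > 0"
  then obtain h M where h: "h \<in> sos" and M: "q + pconst (\<delta> / 2) * coshsum M - q * D * h \<in> sos"
    using assms(1) unfolding sos_cancellable_def by (meson half_gt_zero)
  obtain g L where g: "g \<in> sos"
    and L: "q * D * h + pconst (\<delta> / 2) * coshsum L - q * D * h * E * g \<in> sos"
    using assms(2) \<open>\<delta> > 0\<close> unfolding sos_cancellable_def by (meson half_gt_zero)
  define N where "N = max M L"
  have "q + pconst \<delta> * coshsum N - q * (D * E) * (h * g)
     = (q + pconst (\<delta> / 2) * coshsum M - q * D * h)
      + (q * D * h + pconst (\<delta> / 2) * coshsum L - q * D * h * E * g)
      + pconst (\<delta> / 2) * (coshsum N - coshsum M) + pconst (\<delta> / 2) * (coshsum N - coshsum L)"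
    by (rule rpoly_eqI) (simp add: field_simps)
  also have "\<dots> \<in> sos"
    using \<open>\<delta> > 0\<close>
    by (intro sos_add[OF sos_add[OF sos_add[OF M L]]] sos_pconst_mult coshsum_mono) (auto simp: N_def)
  finally show "\<exists>h\<in>sos. \<exists>N. q + pconst \<delta> * coshsum N - q * (D * E) * h \<in> sos"
    using h g by (intro bexI[of _ "h * g"]) auto
qed

lemma sos_cancellable_prod:
  "sos_cancellable (\<Prod>j\<in>(UNIV :: 'n::finite set). (1 + pvar j ^ 2) ^ K :: 'n rpoly)"
proof -
  have pow: "sos_cancellable ((1 + pvar j ^ 2) ^ K :: 'n rpoly)" for j
    by (induction K)
       (simp_all add: sos_cancellable_1 sos_cancellable_mult sos_cancellable_one_plus_square)
  have "sos_cancellable (\<Prod>j\<in>J. (1 + pvar j ^ 2) ^ K :: 'n rpoly)" if "finite J" for J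
    using that by (induction J) (simp_all add: sos_cancellable_1 sos_cancellable_mult pow)
  then show ?thesis by simp
qed

section \<open>A positive kernel on the circle\<close>

text \<open>
  A product of powers of two linear forms in \<open>s\<close>, \<open>t\<close> is a combination of the monomials of its degree.
\<close>

lemma linear_form_mult_expand:
  fixes F :: "'a::comm_ring_1 \<Rightarrow> 'a \<Rightarrow> 'a"
  assumes "\<And>s t. F s t = (\<Sum>b\<le>n. \<kappa> b * s ^ b * t ^ (n - b))"
  shows "\<exists>\<kappa>'. \<forall>s t. (\<alpha> * s + \<beta> * t) * F s t = (\<Sum>b\<le>Suc n. \<kappa>' b * s ^ b * t ^ (Suc n - b))"
proof (intro exI allI)
  fix s t
  define \<kappa>1 where "\<kappa>1 b = (case b of 0 \<Rightarrow> 0 | Suc c \<Rightarrow> \<alpha> * \<kappa> c)" for b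
  define \<kappa>2 where "\<kappa>2 b = (if b \<le> n then \<beta> * \<kappa> b else 0)" for b
  have "(\<Sum>b\<le>Suc n. \<kappa>1 b * s ^ b * t ^ (Suc n - b)) = \<alpha> * s * F s t"
    unfolding assms by (subst sum.atMost_Suc_shift) (simp add: \<kappa>1_def sum_distrib_left mult_ac)
  moreover have "(\<Sum>b\<le>Suc n. \<kappa>2 b * s ^ b * t ^ (Suc n - b)) = \<beta> * t * F s t"
    unfolding assms sum.atMost_Suc
    by (simp add: \<kappa>2_def sum_distrib_left mult_ac Suc_diff_le)
  ultimately show "(\<alpha> * s + \<beta> * t) * F s t
      = (\<Sum>b\<le>Suc n. ((case b of 0 \<Rightarrow> 0 | Suc c \<Rightarrow> \<alpha> * \<kappa> c) + (if b \<le> n then \<beta> * \<kappa> b else 0)) * s ^ b * t ^ (Suc n - b))"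
    unfolding \<kappa>1_def \<kappa>2_def by (simp only: distrib_right sum.distrib)
qed

lemma linear_form_powers_expand:
  fixes \<alpha> \<beta> \<gamma> \<delta> :: "'a::comm_ring_1"
  shows "\<exists>\<kappa>. \<forall>s t. (\<alpha> * s + \<beta> * t) ^ p * (\<gamma> * s + \<delta> * t) ^ q = (\<Sum>b\<le>p+q. \<kappa> b * s ^ b * t ^ (p + q - b))"
proof (induction p)
  case 0
  show ?case
  proof (induction q)
    case 0
    show ?case by (intro exI[of _ "\<lambda>_. 1"]) simp
  next
    case (Suc q)
    then obtain \<kappa> where "\<And>s t. (\<gamma> * s + \<delta> * t) ^ q = (\<Sum>b\<le>q. \<kappa> b * s ^ b * t ^ (q - b))"
      by auto
    from linear_form_mult_expand[of "\<lambda>s t. (\<gamma> * s + \<delta> * t) ^ q", OF this, of \<gamma> \<delta>]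
    show ?case by simp
  qed
next
  case (Suc p)
  then obtain \<kappa> where "\<And>s t. (\<alpha> * s + \<beta> * t) ^ p * (\<gamma> * s + \<delta> * t) ^ q = (\<Sum>b\<le>p+q. \<kappa> b * s ^ b * t ^ (p + q - b))"
    by auto
  from linear_form_mult_expand[of "\<lambda>s t. (\<alpha> * s + \<beta> * t) ^ p * (\<gamma> * s + \<delta> * t) ^ q", OF this, of \<alpha> \<beta>]
  show ?case by (simp add: mult_ac)
qed

text \<open>
  Orthogonality of characters on the equidistant half-angles \<open>\<pi> k / M\<close>, for the even frequency
  \<open>A - B = 2 (m - n)\<close>.
\<close>

lemma sum_cis_grid:
  assumes "B + 2 * m = A + 2 * n" "n < m + M" "m < n + M"
  shows "(\<Sum>k<M. cis (pi * real k / real M) ^ A * cis (- (pi * real k / real M)) ^ B)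
     = (if m = n then of_nat M else 0)"
proof -
  have M: "M > 0" using assms by auto
  define z where "z = cis (2 * pi * ((real m - real n) / real M))"
  have "real A - real B = 2 * (real m - real n)"
    using arg_cong[OF assms(1), of real] by simp
  then have arg: "(real A - real B) * (pi * real k / real M) = real k * (2 * pi * ((real m - real n) / real M))" for k
    by simp
  have "cis (pi * real k / real M) ^ A * cis (- (pi * real k / real M)) ^ B = z ^ k" for k
  proof -
    have "cis (pi * real k / real M) ^ A * cis (- (pi * real k / real M)) ^ B
        = cis ((real A - real B) * (pi * real k / real M))"
      unfolding Complex.DeMoivre cis_mult by (rule arg_cong[of _ _ cis]) (simp add: left_diff_distrib diff_divide_distrib)
    also have "\<dots> = z ^ k"
      unfolding arg by (simp only: z_def Complex.DeMoivre)
    finally show ?thesis .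
  qed
  then have eq: "(\<Sum>k<M. cis (pi * real k / real M) ^ A * cis (- (pi * real k / real M)) ^ B) = (\<Sum>k<M. z ^ k)"
    by simp
  show ?thesis
  proof (cases "m = n")
    case True
    then show ?thesis unfolding eq by (simp add: z_def)
  next
    case False
    have "z ^ M = cis (2 * pi * of_int (int m - int n))"
      unfolding z_def Complex.DeMoivre using M by (intro arg_cong[of _ _ cis]) simp
    also have "\<dots> = 1" by (rule cis_multiple_2pi) auto
    finally have zM: "z ^ M = 1" .
    have "z \<noteq> 1"
    proof
      assume "z = 1"
      then have "cos (2 * pi * ((real m - real n) / real M)) = 1"
        by (simp add: z_def complex_eq_iff)
      then obtain i :: int where "2 * pi * ((real m - real n) / real M) = of_int i * 2 * pi"
        using cos_one_2pi_int by auto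
      then have "2 * pi * ((real m - real n) / real M) = 2 * pi * of_int i"
        by (simp only: mult_ac)
      then have "(real m - real n) / real M = of_int i"
        by (simp only: mult_cancel_left) simp
      then have "real_of_int (int m - int n) = of_int (i * int M)"
        using M by (simp add: divide_eq_eq)
      then have i: "int m - int n = i * int M" by (simp only: of_int_eq_iff)
      moreover have "i \<noteq> 0" using i False by auto
      ultimately have "\<bar>int m - int n\<bar> \<ge> int M"
        by (simp add: abs_mult) (metis mult_right_mono mult_1 of_nat_0_le_iff zero_less_abs_iff zless_imp_add1_zle add_0)
      then show False using assms by linarith
    qed
    then show ?thesis using False zM unfolding eq by (simp add: sum_gp_strict)
  qed
qed

lemma binomial_ratio_tendsto_1:
  "(\<lambda>N. real (2 * N choose (N + k)) / real (2 * N choose N)) \<longlonglongrightarrow> 1"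
proof (induction k)
  case 0
  show ?case by simp
next
  case (Suc k)
  have "\<forall>\<^sub>F N in sequentially. real (2 * N choose (N + Suc k)) / real (2 * N choose N)
     = real (2 * N choose (N + k)) / real (2 * N choose N) * ((real N - real k) / (real N + real k + 1))"
    using eventually_ge_at_top[of k]
  proof eventually_elim
    case (elim N)
    have "Suc (N + k) * (2 * N choose Suc (N + k)) = (2 * N - (N + k)) * (2 * N choose (N + k))"
      using binomial_absorption[of "N + k" "2 * N"] binomial_absorb_comp[of "2 * N" "N + k"] by simp
    then have "real (Suc (N + k) * (2 * N choose Suc (N + k))) = real ((N - k) * (2 * N choose (N + k)))"
      using elim by simp
    then have "(real N + real k + 1) * real (2 * N choose Suc (N + k)) = (real N - real k) * real (2 * N choose (N + k))"
      using elim by (simp add: of_nat_diff algebra_simps)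
    moreover have "real N + real k + 1 \<noteq> 0" by linarith
    ultimately have "real (2 * N choose (N + Suc k))
        = real (2 * N choose (N + k)) * ((real N - real k) / (real N + real k + 1))"
      by (simp add: eq_divide_eq mult.commute)
    then show ?case by simp
  qed
  moreover have "(\<lambda>N. (real N - real k) / (real N + real k + 1)) \<longlonglongrightarrow> 1"
    by real_asymp
  with Suc have "(\<lambda>N. real (2 * N choose (N + k)) / real (2 * N choose N) * ((real N - real k) / (real N + real k + 1))) \<longlonglongrightarrow> 1 * 1"
    by (intro tendsto_mult)
  ultimately show ?case using tendsto_cong by fastforce
qed

lemma binomial_ratio_shift_tendsto_1:
  "(\<lambda>N. real (2 * N choose (N + l - m)) / real (2 * N choose N)) \<longlonglongrightarrow> 1"
proof (cases "m \<le> l")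
  case True
  then show ?thesis using binomial_ratio_tendsto_1[of "l - m"] by simp
next
  case False
  have "\<forall>\<^sub>F N in sequentially. real (2 * N choose (N + l - m)) / real (2 * N choose N)
     = real (2 * N choose (N + (m - l))) / real (2 * N choose N)"
    using eventually_ge_at_top[of "m"]
  proof eventually_elim
    case (elim N)
    have "2 * N - (N + l - m) = N + (m - l)" using elim False by simp
    then show ?case using binomial_symmetric[of "N + l - m" "2 * N"] elim False by simp
  qed
  from tendsto_cong[OF this] binomial_ratio_tendsto_1[of "m - l"] show ?thesis by blast
qed

text \<open>
  With \<open>x = tan \<theta>\<close>, the kernel \<open>(cos \<phi> + sin \<phi> x) ^ (2 * N) = cos (\<theta> - \<phi>) ^ (2 * N) (1 + x\<^sup>2) ^ N\<close> is
  the kernel of de la Vallee Poussin, up to the factor \<open>(1 + x\<^sup>2) ^ N\<close>.  Convolution with it is diagonal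
  on the characters \<open>exp (2 \<i> l \<theta>)\<close>, with normalized eigenvalues that tend to \<open>1\<close> as \<open>N\<close> grows, and the
  average over a fine enough grid computes the convolution exactly.  Hence it maps \<open>x ^ a\<close>, \<open>a \<le> 2 * m\<close>,
  to \<open>(1 + x\<^sup>2) ^ (N - m)\<close> times a polynomial of degree at most \<open>2 * m\<close> whose coefficients \<open>\<rho> N a b\<close> are
  close to those of \<open>x ^ a\<close>.  In the proof, \<open>u = 1 + \<i> x\<close> and \<open>v = 1 - \<i> x\<close> play the roles of
  \<open>exp (\<i> \<theta>)\<close> and \<open>exp (- \<i> \<theta>)\<close>.
\<close>

lemma circle_kernel:
  "\<exists>\<rho> :: nat \<Rightarrow> nat \<Rightarrow> nat \<Rightarrow> real.
     (\<forall>a\<le>2*m. \<forall>b\<le>2*m. (\<lambda>N. \<rho> N a b) \<longlonglongrightarrow> (if a = b then 1 else 0)) \<and>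
     (\<forall>N\<ge>m. \<exists>\<alpha>>0. \<exists>(M::nat) \<phi>. (\<forall>k<M. cos (\<phi> k) \<noteq> 0) \<and>
        (\<forall>a\<le>2*m. \<forall>x. \<alpha> * (\<Sum>k<M. cos (\<phi> k) ^ (2*m-a) * sin (\<phi> k) ^ a * (cos (\<phi> k) + sin (\<phi> k) * x) ^ (2*N))
           = (1 + x\<^sup>2) ^ (N - m) * (\<Sum>b\<le>2*m. \<rho> N a b * x ^ b)))"
proof -
  define u v :: "real \<Rightarrow> complex" where "u x = 1 + \<i> * of_real x" and "v x = 1 - \<i> * of_real x" for x
  have "\<forall>a. \<exists>g. a \<le> 2*m \<longrightarrow> (\<forall>s t. (1/2 * s + 1/2 * t) ^ (2*m-a) * (- \<i>/2 * s + \<i>/2 * t) ^ a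
      = (\<Sum>l\<le>2*m. g l * s ^ l * t ^ (2*m-l)))"
  proof
    fix a
    show "\<exists>g. a \<le> 2*m \<longrightarrow> (\<forall>s t. (1/2 * s + 1/2 * t) ^ (2*m-a) * (- \<i>/2 * s + \<i>/2 * t) ^ a
      = (\<Sum>l\<le>2*m. g l * s ^ l * t ^ (2*m-l)))"
    proof (cases "a \<le> 2*m")
      case True
      then have "2*m - a + a = 2*m" by simp
      with linear_form_powers_expand[of "1/2::complex" "1/2" "2*m-a" "-\<i>/2" "\<i>/2" a]
      show ?thesis by (simp only:) blast
    qed simp
  qed
  from choice[OF this] obtain \<gamma> where \<gamma>: "\<And>a s t. a \<le> 2*m \<Longrightarrow>
      (1/2 * s + 1/2 * t) ^ (2*m-a) * (- \<i>/2 * s + \<i>/2 * t) ^ a = (\<Sum>l\<le>2*m. \<gamma> a l * s ^ l * t ^ (2*m-l))"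
    by blast
  have "\<forall>l. \<exists>k. l \<le> 2*m \<longrightarrow> (\<forall>x. u x ^ l * v x ^ (2*m-l) = (\<Sum>b\<le>2*m. k b * of_real x ^ b))"
  proof
    fix l
    show "\<exists>k. l \<le> 2*m \<longrightarrow> (\<forall>x. u x ^ l * v x ^ (2*m-l) = (\<Sum>b\<le>2*m. k b * of_real x ^ b))"
    proof (cases "l \<le> 2*m")
      case True
      then have "l + (2*m - l) = 2*m" by simp
      with linear_form_powers_expand[of \<i> 1 l "-\<i>" 1 "2*m-l"]
      obtain k where k: "\<And>s t. (\<i> * s + 1 * t) ^ l * (- \<i> * s + 1 * t) ^ (2*m-l) = (\<Sum>b\<le>2*m. k b * s ^ b * t ^ (2*m-b))"
        by (simp only:) blast
      have "u x ^ l * v x ^ (2*m-l) = (\<Sum>b\<le>2*m. k b * of_real x ^ b)" for x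
        using k[of "of_real x" 1] by (simp add: u_def v_def add.commute)
      then show ?thesis by blast
    qed simp
  qed
  from choice[OF this] obtain \<kappa> where \<kappa>: "\<And>l x. l \<le> 2*m \<Longrightarrow>
      u x ^ l * v x ^ (2*m-l) = (\<Sum>b\<le>2*m. \<kappa> l b * of_real x ^ b)"
    by blast
  \<comment> \<open>the eigenvalue of the character with index \<open>l - m\<close>\<close>
  define ev :: "nat \<Rightarrow> nat \<Rightarrow> real" where "ev N l = real (2*N choose (N+l-m)) / real (2*N choose N)" for N l
  define \<rho> where "\<rho> N a b = Re (\<Sum>l\<le>2*m. \<gamma> a l * of_real (ev N l) * \<kappa> l b)" for N a b
  \<comment> \<open>inserting \<open>s = u\<close>, \<open>t = v\<close> recovers \<open>x ^ a\<close>\<close>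
  have limit: "Re (\<Sum>l\<le>2*m. \<gamma> a l * \<kappa> l b) = (if a = b then 1 else 0)" if ab: "a \<le> 2*m" "b \<le> 2*m" for a b
  proof -
    have "(\<Sum>b\<le>2*m. Re (\<Sum>l\<le>2*m. \<gamma> a l * \<kappa> l b) * x ^ b) = (\<Sum>b\<le>2*m. (if a = b then 1 else 0) * x ^ b)" for x
    proof -
      have "of_real (x ^ a) = (1/2 * u x + 1/2 * v x) ^ (2*m-a) * (- \<i>/2 * u x + \<i>/2 * v x) ^ a"
      proof -
        have "1/2 * u x + 1/2 * v x = 1" "- \<i>/2 * u x + \<i>/2 * v x = of_real x"
          by (simp_all add: u_def v_def algebra_simps)
        then show ?thesis by simp
      qed
      also have "\<dots> = (\<Sum>l\<le>2*m. \<gamma> a l * (u x ^ l * v x ^ (2*m-l)))"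
        using \<gamma>[OF ab(1), of "u x" "v x"] by (simp only: mult.assoc)
      also have "\<dots> = (\<Sum>l\<le>2*m. \<gamma> a l * (\<Sum>b\<le>2*m. \<kappa> l b * of_real x ^ b))"
        by (intro sum.cong) (auto simp: \<kappa>)
      also have "\<dots> = (\<Sum>b\<le>2*m. (\<Sum>l\<le>2*m. \<gamma> a l * \<kappa> l b) * of_real (x ^ b))"
        unfolding sum_distrib_left sum_distrib_right by (subst sum.swap) (simp add: mult_ac)
      finally have "Re (of_real (x ^ a)) = Re (\<Sum>b\<le>2*m. (\<Sum>l\<le>2*m. \<gamma> a l * \<kappa> l b) * of_real (x ^ b))"
        by (rule arg_cong)
      also have "\<dots> = (\<Sum>b\<le>2*m. Re (\<Sum>l\<le>2*m. \<gamma> a l * \<kappa> l b) * x ^ b)"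
        by (subst Re_sum) (simp only: times_complex.sel Re_complex_of_real Im_complex_of_real mult_zero_right diff_0_right)
      finally show ?thesis using ab by (simp add: if_distrib[of "\<lambda>c. c * _"] cong: if_cong)
    qed
    then have "\<forall>b\<le>2*m. Re (\<Sum>l\<le>2*m. \<gamma> a l * \<kappa> l b) = (if a = b then 1 else 0)"
      by (intro polyfun_eq_coeffs[THEN iffD1] allI)
    then show ?thesis using ab by blast
  qed
  have "(\<lambda>N. \<rho> N a b) \<longlonglongrightarrow> (if a = b then 1 else 0)" if ab: "a \<le> 2*m" "b \<le> 2*m" for a b
  proof -
    have "(\<lambda>N. \<rho> N a b) \<longlonglongrightarrow> Re (\<Sum>l\<le>2*m. \<gamma> a l * of_real 1 * \<kappa> l b)"
      unfolding \<rho>_def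
      by (intro tendsto_intros) (simp add: ev_def binomial_ratio_shift_tendsto_1)
    then show ?thesis using limit[OF ab] by simp
  qed
  moreover have "\<exists>\<alpha>>0. \<exists>(M::nat) \<phi>. (\<forall>k<M. cos (\<phi> k) \<noteq> 0) \<and>
        (\<forall>a\<le>2*m. \<forall>x. \<alpha> * (\<Sum>k<M. cos (\<phi> k) ^ (2*m-a) * sin (\<phi> k) ^ a * (cos (\<phi> k) + sin (\<phi> k) * x) ^ (2*N))
           = (1 + x\<^sup>2) ^ (N - m) * (\<Sum>b\<le>2*m. \<rho> N a b * x ^ b))" if N: "N \<ge> m" for N
  proof -
    \<comment> \<open>odd, so that the grid avoids the angle \<open>\<pi>/2\<close>, and larger than all frequencies that occur\<close>
    define M where "M = 2 * (N + m) + 1"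
    define \<phi> where "\<phi> k = pi * real k / real M" for k
    define \<alpha> where "\<alpha> = 4 ^ N / (real M * real (2*N choose N))"
    have M: "M > 0" by (simp add: M_def)
    have "\<alpha> > 0" using M by (simp add: \<alpha>_def)
    moreover have "cos (\<phi> k) \<noteq> 0" for k
    proof
      assume "cos (\<phi> k) = 0"
      then obtain i :: int where i: "odd i" "\<phi> k = of_int i * (pi / 2)"
        using cos_zero_iff_int by blast
      then have "real_of_int (2 * int k) = real_of_int (i * int M)"
        using M by (simp add: \<phi>_def field_simps)
      then have "2 * int k = i * int M" by (simp only: of_int_eq_iff)
      then have "even (i * int M)" by (metis dvd_triv_left)
      then show False using i by (simp add: M_def)
    qed
    moreover have "\<alpha> * (\<Sum>k<M. cos (\<phi> k) ^ (2*m-a) * sin (\<phi> k) ^ a * (cos (\<phi> k) + sin (\<phi> k) * x) ^ (2*N))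
           = (1 + x\<^sup>2) ^ (N - m) * (\<Sum>b\<le>2*m. \<rho> N a b * x ^ b)" if a: "a \<le> 2*m" for a x
    proof -
      define z z' where "z k = cis (\<phi> k)" and "z' k = cis (- \<phi> k)" for k
      have cos: "complex_of_real (cos (\<phi> k)) = 1/2 * z k + 1/2 * z' k" for k
        by (simp add: z_def z'_def complex_eq_iff)
      have sin: "complex_of_real (sin (\<phi> k)) = - \<i>/2 * z k + \<i>/2 * z' k" for k
        by (simp add: z_def z'_def complex_eq_iff)
      have lin: "complex_of_real (cos (\<phi> k) + sin (\<phi> k) * x) = 1/2 * (z' k * u x + z k * v x)" for k
        unfolding of_real_add of_real_mult cos sin u_def v_def by (simp add: algebra_simps)
      have kernel: "complex_of_real ((cos (\<phi> k) + sin (\<phi> k) * x) ^ (2*N))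
          = (1/4) ^ N * (\<Sum>j\<le>2*N. of_nat (2*N choose j) * (z' k * u x) ^ j * (z k * v x) ^ (2*N-j))" for k
      proof -
        have "complex_of_real ((cos (\<phi> k) + sin (\<phi> k) * x) ^ (2*N)) = (1/2) ^ (2*N) * (z' k * u x + z k * v x) ^ (2*N)"
          unfolding of_real_power lin by (rule power_mult_distrib)
        also have "(1/2 :: complex) ^ (2*N) = (1/4) ^ N"
          by (simp add: power_mult power2_eq_square)
        finally show ?thesis by (simp only: binomial_ring)
      qed
      have mono: "complex_of_real (cos (\<phi> k) ^ (2*m-a) * sin (\<phi> k) ^ a) = (\<Sum>l\<le>2*m. \<gamma> a l * z k ^ l * z' k ^ (2*m-l))" for k
        unfolding of_real_mult of_real_power cos sin by (rule \<gamma>[OF a])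
      have orth: "(\<Sum>k<M. z k ^ (l + (2*N-j)) * z' k ^ (2*m-l+j)) = (if j + m = N + l then of_nat M else 0)"
        if "l \<le> 2*m" "j \<le> 2*N" for l j
        unfolding z_def z'_def \<phi>_def using that N
        by (subst sum_cis_grid[where m = "N + l" and n = "j + m"]) (auto simp: M_def)
      have uv: "u x * v x = of_real (1 + x\<^sup>2)"
        by (simp add: u_def v_def power2_eq_square algebra_simps)
      have "complex_of_real (\<Sum>k<M. cos (\<phi> k) ^ (2*m-a) * sin (\<phi> k) ^ a * (cos (\<phi> k) + sin (\<phi> k) * x) ^ (2*N))
          = (\<Sum>k<M. (\<Sum>l\<le>2*m. \<gamma> a l * z k ^ l * z' k ^ (2*m-l))
              * ((1/4) ^ N * (\<Sum>j\<le>2*N. of_nat (2*N choose j) * (z' k * u x) ^ j * (z k * v x) ^ (2*N-j))))"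
        unfolding of_real_sum of_real_mult[of "_ * _"] kernel mono ..
      also have "\<dots> = (\<Sum>k<M. \<Sum>l\<le>2*m. \<Sum>j\<le>2*N. (1/4) ^ N * \<gamma> a l * of_nat (2*N choose j) * u x ^ j * v x ^ (2*N-j)
          * (z k ^ (l + (2*N-j)) * z' k ^ (2*m-l+j)))"
        unfolding sum_distrib_left[of "(1/4) ^ N"] sum_product
        by (intro sum.cong refl) (simp only: power_mult_distrib power_add mult_ac)
      also have "\<dots> = (\<Sum>l\<le>2*m. \<Sum>k<M. \<Sum>j\<le>2*N. (1/4) ^ N * \<gamma> a l * of_nat (2*N choose j) * u x ^ j * v x ^ (2*N-j)
          * (z k ^ (l + (2*N-j)) * z' k ^ (2*m-l+j)))"
        by (rule sum.swap)
      also have "\<dots> = (\<Sum>l\<le>2*m. \<Sum>j\<le>2*N. \<Sum>k<M. (1/4) ^ N * \<gamma> a l * of_nat (2*N choose j) * u x ^ j * v x ^ (2*N-j)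
          * (z k ^ (l + (2*N-j)) * z' k ^ (2*m-l+j)))"
        by (intro sum.cong refl sum.swap)
      also have "\<dots> = (\<Sum>l\<le>2*m. \<Sum>j\<le>2*N. (1/4) ^ N * \<gamma> a l * of_nat (2*N choose j) * u x ^ j * v x ^ (2*N-j)
          * (if j + m = N + l then of_nat M else 0))"
        by (intro sum.cong refl) (simp only: sum_distrib_left[symmetric] atMost_iff orth)
      also have "\<dots> = (\<Sum>l\<le>2*m. (1/4) ^ N * of_nat M * \<gamma> a l * of_nat (2*N choose (N+l-m)) * (u x * v x) ^ (N-m) * (u x ^ l * v x ^ (2*m-l)))"
      proof (intro sum.cong refl)
        fix l assume l: "l \<in> {..2*m}"
        let ?f = "\<lambda>j. (1/4) ^ N * \<gamma> a l * of_nat (2*N choose j) * u x ^ j * v x ^ (2*N-j)"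
        have "(\<Sum>j\<le>2*N. ?f j * (if j + m = N + l then of_nat M else 0))
            = (\<Sum>j\<le>2*N. if j = N + l - m then ?f j * of_nat M else 0)"
          using N by (intro sum.cong) auto
        also have "\<dots> = ?f (N + l - m) * of_nat M"
          using N l by simp
        also have "u x ^ (N + l - m) = u x ^ (N - m) * u x ^ l"
          using N by (simp flip: power_add)
        also have "2*N - (N + l - m) = (N - m) + (2*m - l)"
          using N l by simp
        finally show "(\<Sum>j\<le>2*N. ?f j * (if j + m = N + l then of_nat M else 0))
          = (1/4) ^ N * of_nat M * \<gamma> a l * of_nat (2*N choose (N+l-m)) * (u x * v x) ^ (N-m) * (u x ^ l * v x ^ (2*m-l))"
          by (simp add: power_add power_mult_distrib mult_ac)
      qed
      finally have main: "complex_of_real (\<Sum>k<M. cos (\<phi> k) ^ (2*m-a) * sin (\<phi> k) ^ a * (cos (\<phi> k) + sin (\<phi> k) * x) ^ (2*N)) = \<dots>" .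
      have "complex_of_real (\<alpha> * (\<Sum>k<M. cos (\<phi> k) ^ (2*m-a) * sin (\<phi> k) ^ a * (cos (\<phi> k) + sin (\<phi> k) * x) ^ (2*N)))
          = (\<Sum>l\<le>2*m. of_real (\<alpha> * (1/4) ^ N * M * real (2*N choose (N+l-m)) * (1 + x\<^sup>2) ^ (N-m)) * \<gamma> a l * (u x ^ l * v x ^ (2*m-l)))"
        unfolding of_real_mult[of \<alpha>] main uv
        by (subst sum_distrib_left, rule sum.cong) (simp_all add: mult_ac)
      also have "\<dots> = (\<Sum>l\<le>2*m. of_real ((1 + x\<^sup>2) ^ (N-m)) * (\<gamma> a l * of_real (ev N l) * (\<Sum>b\<le>2*m. \<kappa> l b * of_real x ^ b)))"
      proof (intro sum.cong refl)
        fix l assume "l \<in> {..2*m}"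
        then have l: "l \<le> 2*m" by simp
        have eq: "\<alpha> * (1/4) ^ N * M * real (2*N choose (N+l-m)) * (1 + x\<^sup>2) ^ (N-m) = (1 + x\<^sup>2) ^ (N-m) * ev N l"
          using M by (simp add: \<alpha>_def ev_def field_simps)
        show "of_real (\<alpha> * (1/4) ^ N * M * real (2*N choose (N+l-m)) * (1 + x\<^sup>2) ^ (N-m)) * \<gamma> a l * (u x ^ l * v x ^ (2*m-l))
          = of_real ((1 + x\<^sup>2) ^ (N-m)) * (\<gamma> a l * of_real (ev N l) * (\<Sum>b\<le>2*m. \<kappa> l b * of_real x ^ b))"
          unfolding eq \<kappa>[OF l, symmetric] of_real_mult by (simp only: mult_ac)
      qed
      also have "\<dots> = of_real ((1 + x\<^sup>2) ^ (N-m)) * (\<Sum>b\<le>2*m. (\<Sum>l\<le>2*m. \<gamma> a l * of_real (ev N l) * \<kappa> l b) * of_real (x ^ b))"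
        unfolding sum_distrib_left[symmetric]
        by (rule arg_cong[where f = "(*) _"])
           (unfold sum_distrib_left sum_distrib_right, subst sum.swap, simp add: mult_ac)
      finally have "Re (complex_of_real (\<alpha> * (\<Sum>k<M. cos (\<phi> k) ^ (2*m-a) * sin (\<phi> k) ^ a * (cos (\<phi> k) + sin (\<phi> k) * x) ^ (2*N))))
         = Re (of_real ((1 + x\<^sup>2) ^ (N-m)) * (\<Sum>b\<le>2*m. (\<Sum>l\<le>2*m. \<gamma> a l * of_real (ev N l) * \<kappa> l b) * of_real (x ^ b)))"
        by (rule arg_cong)
      then show ?thesis
        unfolding times_complex.sel(1)[of "of_real _"] Re_sum[of "\<lambda>b. (\<Sum>l\<le>2*m. \<gamma> a l * of_real (ev N l) * \<kappa> l b) * of_real (x ^ b)" "{..2*m}"]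
        by (simp only: \<rho>_def times_complex.sel Re_complex_of_real Im_complex_of_real mult_zero_right mult_zero_left diff_0_right)
    qed
    ultimately show ?thesis by blast
  qed
  ultimately show ?thesis by blast
qed

section \<open>Nonnegative polynomials\<close>

text \<open>A combination of fixed polynomials with small coefficients is a small perturbation.\<close>

lemma sum_small_multiples_bounded:
  fixes X :: "'i \<Rightarrow> ('n::finite) rpoly"
  assumes "finite B"
  shows "\<exists>C N. C \<ge> 0 \<and> (\<forall>e. pconst (C * (\<Sum>\<beta>\<in>B. \<bar>e \<beta>\<bar>)) * coshsum N + (\<Sum>\<beta>\<in>B. pconst (e \<beta>) * X \<beta>) \<in> sos)"
proof -
  define Q where "Q = (\<Sum>\<beta>\<in>B. (X \<beta>)\<^sup>2)"
  obtain C N where C: "C \<ge> 0" and N: "pconst C * coshsum N - (1 + Q) \<in> sos"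
    using ex_coshsum_bound[of "1 + Q"] by auto
  show ?thesis
  proof (intro exI conjI allI)
    show "C \<ge> 0" by (rule C)
    fix e :: "'i \<Rightarrow> real"
    have "pconst (C * \<bar>e \<beta>\<bar>) * coshsum N + pconst (e \<beta>) * X \<beta> \<in> sos" if "\<beta> \<in> B" for \<beta>
    proof -
      have Q: "Q = (X \<beta>)\<^sup>2 + (\<Sum>\<beta>'\<in>B-{\<beta>}. (X \<beta>')\<^sup>2)"
        unfolding Q_def using assms that by (subst sum.remove) auto
      \<comment> \<open>\<open>X\<^sup>2 + s X + 1 = (X + s/2)\<^sup>2 + 3/4 + (1 - s\<^sup>2)/4\<close> for the sign \<open>s\<close> of the coefficient\<close>
      have "pconst (C * \<bar>e \<beta>\<bar>) * coshsum N + pconst (e \<beta>) * X \<beta>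
          = pconst \<bar>e \<beta>\<bar> * ((pconst C * coshsum N - (1 + Q)) + (\<Sum>\<beta>'\<in>B-{\<beta>}. (X \<beta>')\<^sup>2)
              + pconst (3/4) + (pconst (sgn (e \<beta>) / 2) + X \<beta>)\<^sup>2 + pconst ((1 - (sgn (e \<beta>))\<^sup>2) / 4))"
      proof (rule rpoly_eqI)
        fix \<xi>
        have "e \<beta> = \<bar>e \<beta>\<bar> * sgn (e \<beta>)" by (simp add: abs_mult_sgn)
        then have "e \<beta> * peval (X \<beta>) \<xi> = \<bar>e \<beta>\<bar> * (sgn (e \<beta>) * peval (X \<beta>) \<xi>)" by simp
        then show "peval (pconst (C * \<bar>e \<beta>\<bar>) * coshsum N + pconst (e \<beta>) * X \<beta>) \<xi>
          = peval (pconst \<bar>e \<beta>\<bar> * ((pconst C * coshsum N - (1 + Q)) + (\<Sum>\<beta>'\<in>B-{\<beta>}. (X \<beta>')\<^sup>2)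
              + pconst (3/4) + (pconst (sgn (e \<beta>) / 2) + X \<beta>)\<^sup>2 + pconst ((1 - (sgn (e \<beta>))\<^sup>2) / 4))) \<xi>"
          unfolding Q peval_add peval_diff peval_mult peval_pconst peval_power peval_one
          by (simp add: power2_eq_square algebra_simps add_divide_distrib diff_divide_distrib)
      qed
      also have "\<dots> \<in> sos"
        by (intro sos_pconst_mult sos_add N sos_sum sos_square sos_pconst) (auto simp: sgn_if)
      finally show ?thesis .
    qed
    then have "(\<Sum>\<beta>\<in>B. pconst (C * \<bar>e \<beta>\<bar>) * coshsum N + pconst (e \<beta>) * X \<beta>) \<in> sos"
      by (rule sos_sum)
    also have "(\<Sum>\<beta>\<in>B. pconst (C * \<bar>e \<beta>\<bar>) * coshsum N + pconst (e \<beta>) * X \<beta>)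
        = pconst (C * (\<Sum>\<beta>\<in>B. \<bar>e \<beta>\<bar>)) * coshsum N + (\<Sum>\<beta>\<in>B. pconst (e \<beta>) * X \<beta>)"
      by (rule rpoly_eqI) (simp add: peval_sum sum.distrib sum_distrib_left sum_distrib_right)
    finally show "pconst (C * (\<Sum>\<beta>\<in>B. \<bar>e \<beta>\<bar>)) * coshsum N + (\<Sum>\<beta>\<in>B. pconst (e \<beta>) * X \<beta>) \<in> sos" .
  qed
qed

text \<open>
  The kernel operator of \<open>circle_kernel\<close>, applied in each variable, maps a nonnegative \<open>p\<close> to a combination
  of squares with nonnegative coefficients, essentially the values of \<open>p\<close> on a grid.
\<close>

lemma nonneg_approx_by_sos_quotient:
  fixes p :: "('n::finite) rpoly"
  assumes nonneg: "\<And>\<xi>. peval p \<xi> \<ge> 0" and "\<delta> > 0"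
  shows "\<exists>r K N. r * (\<Prod>j\<in>UNIV. (1 + pvar j ^ 2) ^ K) \<in> sos \<and> p - r + pconst \<delta> * coshsum N \<in> sos"
proof -
  define S where "S = Poly_Mapping.keys p"
  define cf where "cf = Poly_Mapping.lookup p"
  define ex where "ex = (Poly_Mapping.lookup :: ('n \<Rightarrow>\<^sub>0 nat) \<Rightarrow> _)"
  have S: "finite S" by (simp add: S_def)
  have p: "peval p \<xi> = (\<Sum>a\<in>S. cf a * (\<Prod>j\<in>UNIV. (\<xi> $ j) ^ ex a j))" for \<xi>
    by (simp add: peval_def S_def cf_def ex_def)
  have "finite ((\<lambda>(a, j). ex a j) ` (S \<times> UNIV))"
    using S by auto
  from bdd_above_finite[OF this] obtain m where "\<forall>n\<in>(\<lambda>(a, j). ex a j) ` (S \<times> UNIV). n \<le> m"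
    unfolding bdd_above_def by auto
  then have "ex a j \<le> m" if "a \<in> S" for a j
    using that by auto
  then have m: "ex a j \<le> 2*m" if "a \<in> S" for a j
    using that by (simp add: trans_le_add1 mult_2)
  obtain \<rho> :: "nat \<Rightarrow> nat \<Rightarrow> nat \<Rightarrow> real" where
    "(\<forall>a\<le>2*m. \<forall>b\<le>2*m. (\<lambda>N. \<rho> N a b) \<longlonglongrightarrow> (if a = b then 1 else 0)) \<and>
     (\<forall>N\<ge>m. \<exists>\<alpha>>0. \<exists>(M::nat) \<phi>. (\<forall>k<M. cos (\<phi> k) \<noteq> 0) \<and>
        (\<forall>a\<le>2*m. \<forall>x. \<alpha> * (\<Sum>k<M. cos (\<phi> k) ^ (2*m-a) * sin (\<phi> k) ^ a * (cos (\<phi> k) + sin (\<phi> k) * x) ^ (2*N))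
           = (1 + x\<^sup>2) ^ (N - m) * (\<Sum>b\<le>2*m. \<rho> N a b * x ^ b)))"
    using circle_kernel[of m] by (elim exE)
  note lim = conjunct1[OF this, rule_format] and ker = conjunct2[OF this, rule_format]
  define B where "B = (PiE UNIV (\<lambda>_. {..2*m}) :: ('n \<Rightarrow> nat) set)"
  have B: "finite B" unfolding B_def by (intro finite_PiE) auto
  define X where "X \<beta> = (\<Prod>j\<in>UNIV. pvar j ^ \<beta> j :: 'n rpoly)" for \<beta> :: "'n \<Rightarrow> nat"
  define d where "d N \<beta> = (\<Sum>a\<in>S. cf a * (\<Prod>j\<in>UNIV. \<rho> N (ex a j) (\<beta> j)))" for N \<beta>
  define d0 where "d0 \<beta> = (\<Sum>a\<in>S. cf a * (\<Prod>j\<in>UNIV. if ex a j = \<beta> j then 1 else 0))" for \<beta>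
  \<comment> \<open>the image of \<open>p\<close> under the kernel operator, without the powers of \<open>1 + x\<^sub>j\<^sup>2\<close>\<close>
  define r where "r N = (\<Sum>\<beta>\<in>B. pconst (d N \<beta>) * X \<beta>)" for N
  have r: "peval (r N) \<xi> = (\<Sum>a\<in>S. cf a * (\<Prod>j\<in>UNIV. \<Sum>b\<le>2*m. \<rho> N (ex a j) b * (\<xi> $ j) ^ b))" for N \<xi>
  proof -
    have "peval (r N) \<xi> = (\<Sum>\<beta>\<in>B. \<Sum>a\<in>S. cf a * ((\<Prod>j\<in>UNIV. \<rho> N (ex a j) (\<beta> j)) * (\<Prod>j\<in>UNIV. (\<xi> $ j) ^ \<beta> j)))"
      by (simp add: r_def peval_sum X_def peval_prod d_def sum_distrib_right mult.assoc)
    also have "\<dots> = (\<Sum>a\<in>S. cf a * (\<Sum>\<beta>\<in>B. \<Prod>j\<in>UNIV. \<rho> N (ex a j) (\<beta> j) * (\<xi> $ j) ^ \<beta> j))"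
      by (subst sum.swap) (simp add: sum_distrib_left prod.distrib)
    also have "\<dots> = (\<Sum>a\<in>S. cf a * (\<Prod>j\<in>UNIV. \<Sum>b\<le>2*m. \<rho> N (ex a j) b * (\<xi> $ j) ^ b))"
      unfolding B_def by (subst prod_sum_PiE) auto
    finally show ?thesis .
  qed
  have p_sum: "p = (\<Sum>\<beta>\<in>B. pconst (d0 \<beta>) * X \<beta>)"
  proof (rule rpoly_eqI)
    fix \<xi>
    have "peval (\<Sum>\<beta>\<in>B. pconst (d0 \<beta>) * X \<beta>) \<xi>
       = (\<Sum>\<beta>\<in>B. \<Sum>a\<in>S. cf a * ((\<Prod>j\<in>UNIV. if ex a j = \<beta> j then 1 else 0) * (\<Prod>j\<in>UNIV. (\<xi> $ j) ^ \<beta> j)))"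
      by (simp add: peval_sum X_def peval_prod d0_def sum_distrib_right mult.assoc)
    also have "\<dots> = (\<Sum>a\<in>S. cf a * (\<Sum>\<beta>\<in>B. \<Prod>j\<in>UNIV. (if ex a j = \<beta> j then 1 else 0) * (\<xi> $ j) ^ \<beta> j))"
      by (subst sum.swap) (simp only: sum_distrib_left prod.distrib)
    also have "\<dots> = (\<Sum>a\<in>S. cf a * (\<Prod>j\<in>UNIV. \<Sum>b\<le>2*m. (if ex a j = b then 1 else 0) * (\<xi> $ j) ^ b))"
      unfolding B_def by (subst prod_sum_PiE) auto
    also have "\<dots> = peval p \<xi>"
    proof -
      have "(\<Sum>b\<le>2*m. (if ex a j = b then 1 else 0) * (\<xi> $ j) ^ b) = (\<xi> $ j) ^ ex a j" if "a \<in> S" for a j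
        using m[OF that, of j] by (simp add: if_distrib[of "\<lambda>c. c * _"] cong: if_cong)
      then show ?thesis unfolding p by (intro sum.cong refl arg_cong2[where f = "(*)"] prod.cong) auto
    qed
    finally show "peval p \<xi> = peval (\<Sum>\<beta>\<in>B. pconst (d0 \<beta>) * X \<beta>) \<xi>" ..
  qed
  obtain C L where C: "C \<ge> 0" and L: "\<And>e. pconst (C * (\<Sum>\<beta>\<in>B. \<bar>e \<beta>\<bar>)) * coshsum L + (\<Sum>\<beta>\<in>B. pconst (e \<beta>) * X \<beta>) \<in> sos"
    using sum_small_multiples_bounded[OF B, of X] by auto
  have d_lim: "(\<lambda>N. d N \<beta>) \<longlonglongrightarrow> d0 \<beta>" if "\<beta> \<in> B" for \<beta>
    unfolding d_def d0_def
    by (intro tendsto_sum tendsto_mult tendsto_const tendsto_prod lim) (use m that in \<open>auto simp: B_def PiE_iff\<close>)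
  have "(\<lambda>N. C * (\<Sum>\<beta>\<in>B. \<bar>d0 \<beta> - d N \<beta>\<bar>)) \<longlonglongrightarrow> C * (\<Sum>\<beta>\<in>B. \<bar>d0 \<beta> - d0 \<beta>\<bar>)"
    by (intro tendsto_intros d_lim)
  then have "(\<lambda>N. C * (\<Sum>\<beta>\<in>B. \<bar>d0 \<beta> - d N \<beta>\<bar>)) \<longlonglongrightarrow> 0" by simp
  then have "\<forall>\<^sub>F N in sequentially. C * (\<Sum>\<beta>\<in>B. \<bar>d0 \<beta> - d N \<beta>\<bar>) < \<delta>"
    using \<open>\<delta> > 0\<close> by (rule order_tendstoD)
  then have "\<forall>\<^sub>F N in sequentially. C * (\<Sum>\<beta>\<in>B. \<bar>d0 \<beta> - d N \<beta>\<bar>) < \<delta> \<and> N \<ge> m"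
    by (intro eventually_conj eventually_ge_at_top)
  then obtain N where small: "C * (\<Sum>\<beta>\<in>B. \<bar>d0 \<beta> - d N \<beta>\<bar>) < \<delta>" and N: "N \<ge> m"
    by (auto simp: eventually_sequentially)
  have "p - r N = (\<Sum>\<beta>\<in>B. pconst (d0 \<beta> - d N \<beta>) * X \<beta>)"
    by (subst p_sum, rule rpoly_eqI) (simp add: r_def peval_sum left_diff_distrib sum_subtractf)
  moreover have "pconst \<delta> * coshsum L + (\<Sum>\<beta>\<in>B. pconst (d0 \<beta> - d N \<beta>) * X \<beta>) \<in> sos"
    by (rule sos_coshsum_weaken[OF L]) (use small C in \<open>auto intro!: mult_nonneg_nonneg sum_nonneg\<close>)
  ultimately have close: "p - r N + pconst \<delta> * coshsum L \<in> sos"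
    by (simp add: add.commute)
  obtain \<alpha> and M :: nat and \<phi> where \<alpha>: "\<alpha> > 0" and cos: "\<forall>k<M. cos (\<phi> k) \<noteq> 0"
    and ker': "\<forall>a\<le>2*m. \<forall>x. \<alpha> * (\<Sum>k<M. cos (\<phi> k) ^ (2*m-a) * sin (\<phi> k) ^ a * (cos (\<phi> k) + sin (\<phi> k) * x) ^ (2*N))
           = (1 + x\<^sup>2) ^ (N - m) * (\<Sum>b\<le>2*m. \<rho> N a b * x ^ b)"
    using ker[OF N] by (elim exE conjE) (rule that)
  define G where "G = (PiE UNIV (\<lambda>_. {..<M}) :: ('n \<Rightarrow> nat) set)"
  define Y where "Y g = (\<Prod>j\<in>UNIV. (pconst (cos (\<phi> (g j))) + pconst (sin (\<phi> (g j))) * pvar j) ^ N :: 'n rpoly)" for g :: "'n \<Rightarrow> nat"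
  define h where "h g = (\<Sum>a\<in>S. cf a * (\<Prod>j\<in>UNIV. cos (\<phi> (g j)) ^ (2*m - ex a j) * sin (\<phi> (g j)) ^ ex a j))" for g
  \<comment> \<open>the homogenization of \<open>p\<close> at \<open>(cos, sin)\<close> is a value of \<open>p\<close> times even powers of cosines\<close>
  have h_nonneg: "h g \<ge> 0" if "g \<in> G" for g
  proof -
    define \<xi> :: "real ^ 'n" where "\<xi> = (\<chi> j. sin (\<phi> (g j)) / cos (\<phi> (g j)))"
    have c: "cos (\<phi> (g j)) \<noteq> 0" for j
      using that cos by (auto simp: G_def PiE_iff)
    have "cos (\<phi> (g j)) ^ (2*m - ex a j) * sin (\<phi> (g j)) ^ ex a j = cos (\<phi> (g j)) ^ (2*m) * (\<xi> $ j) ^ ex a j"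
      if "a \<in> S" for a j
    proof -
      have "cos (\<phi> (g j)) ^ (2*m) = cos (\<phi> (g j)) ^ (2*m - ex a j) * cos (\<phi> (g j)) ^ ex a j"
        using m[OF that, of j] by (simp flip: power_add)
      then show ?thesis using c[of j] by (simp add: \<xi>_def power_divide)
    qed
    then have "h g = (\<Sum>a\<in>S. cf a * (\<Prod>j\<in>UNIV. cos (\<phi> (g j)) ^ (2*m) * (\<xi> $ j) ^ ex a j))"
      unfolding h_def by (intro sum.cong refl) (simp only:)
    also have "\<dots> = (\<Prod>j\<in>UNIV. cos (\<phi> (g j)) ^ (2*m)) * peval p \<xi>"
      unfolding p by (simp add: prod.distrib sum_distrib_left mult_ac)
    also have "\<dots> \<ge> 0"
      by (intro mult_nonneg_nonneg prod_nonneg nonneg) (auto simp: power_mult)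
    finally show ?thesis .
  qed
  have "r N * (\<Prod>j\<in>UNIV. (1 + pvar j ^ 2) ^ (N - m)) = (\<Sum>g\<in>G. pconst (\<alpha> ^ CARD('n) * h g) * (Y g)\<^sup>2)"
  proof (rule rpoly_eqI)
    fix \<xi> :: "real ^ 'n"
    let ?c = "\<lambda>k. cos (\<phi> k)" and ?s = "\<lambda>k. sin (\<phi> k)"
    have Y2: "(peval (Y g) \<xi>)\<^sup>2 = (\<Prod>j\<in>UNIV. (?c (g j) + ?s (g j) * \<xi> $ j) ^ (2*N))" for g
      unfolding Y_def peval_prod prod_power_distrib by (simp add: power_mult[symmetric] mult.commute)
    have "peval (r N * (\<Prod>j\<in>UNIV. (1 + pvar j ^ 2) ^ (N - m))) \<xi>
       = (\<Sum>a\<in>S. cf a * (\<Prod>j\<in>UNIV. (1 + (\<xi> $ j)\<^sup>2) ^ (N - m) * (\<Sum>b\<le>2*m. \<rho> N (ex a j) b * (\<xi> $ j) ^ b)))"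
      unfolding peval_mult r peval_prod prod.distrib sum_distrib_right by (simp add: mult_ac)
    also have "\<dots> = (\<Sum>a\<in>S. cf a * (\<Prod>j\<in>UNIV. \<alpha> * (\<Sum>k<M. ?c k ^ (2*m - ex a j) * ?s k ^ ex a j * (?c k + ?s k * \<xi> $ j) ^ (2*N))))"
      by (intro sum.cong refl arg_cong2[where f = "(*)"] prod.cong ker'[rule_format, symmetric] m)
    also have "\<dots> = (\<Sum>a\<in>S. cf a * (\<alpha> ^ CARD('n) * (\<Sum>g\<in>G. \<Prod>j\<in>UNIV. ?c (g j) ^ (2*m - ex a j) * ?s (g j) ^ ex a j * (?c (g j) + ?s (g j) * \<xi> $ j) ^ (2*N))))"
      unfolding G_def prod.distrib[of "\<lambda>_. \<alpha>"] by (subst prod_sum_PiE) auto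
    also have "\<dots> = (\<Sum>a\<in>S. \<Sum>g\<in>G. \<alpha> ^ CARD('n) * (cf a * (\<Prod>j\<in>UNIV. ?c (g j) ^ (2*m - ex a j) * ?s (g j) ^ ex a j)) * (peval (Y g) \<xi>)\<^sup>2)"
      unfolding Y2 sum_distrib_left
      by (intro sum.cong refl) (simp only: prod.distrib mult_ac)
    also have "\<dots> = (\<Sum>g\<in>G. \<alpha> ^ CARD('n) * h g * (peval (Y g) \<xi>)\<^sup>2)"
      unfolding h_def by (subst sum.swap) (simp only: sum_distrib_left sum_distrib_right)
    also have "\<dots> = peval (\<Sum>g\<in>G. pconst (\<alpha> ^ CARD('n) * h g) * (Y g)\<^sup>2) \<xi>"
      by (simp add: peval_sum)
    finally show "peval (r N * (\<Prod>j\<in>UNIV. (1 + pvar j ^ 2) ^ (N - m))) \<xi>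
       = peval (\<Sum>g\<in>G. pconst (\<alpha> ^ CARD('n) * h g) * (Y g)\<^sup>2) \<xi>" .
  qed
  also have "\<dots> \<in> sos"
    using \<alpha> h_nonneg by (intro sos_sum sos_pconst_mult sos_square mult_nonneg_nonneg) auto
  finally show ?thesis using close by blast
qed

lemma nonneg_imp_sos_perturbation:
  fixes p :: "('n::finite) rpoly"
  assumes "\<And>\<xi>. peval p \<xi> \<ge> 0" and "\<epsilon> > 0"
  shows "\<exists>N. p + pconst \<epsilon> * coshsum N \<in> sos"
proof -
  obtain r K M where r: "r * (\<Prod>j\<in>UNIV. (1 + pvar j ^ 2) ^ K) \<in> sos"
    and M: "p - r + pconst (\<epsilon> / 2) * coshsum M \<in> sos"
    using nonneg_approx_by_sos_quotient[OF assms(1), of "\<epsilon> / 2"] \<open>\<epsilon> > 0\<close> by auto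
  obtain h L where h: "h \<in> sos"
    and L: "r + pconst (\<epsilon> / 2) * coshsum L - r * (\<Prod>j\<in>UNIV. (1 + pvar j ^ 2) ^ K) * h \<in> sos"
    using sos_cancellable_prod[of K, where 'n = 'n, unfolded sos_cancellable_def, THEN spec[of _ r], THEN spec[of _ "\<epsilon> / 2"]] \<open>\<epsilon> > 0\<close>
    by auto
  define N where "N = max M L"
  have "p + pconst \<epsilon> * coshsum N
     = (p - r + pconst (\<epsilon> / 2) * coshsum M)
      + (r + pconst (\<epsilon> / 2) * coshsum L - r * (\<Prod>j\<in>UNIV. (1 + pvar j ^ 2) ^ K) * h)
      + r * (\<Prod>j\<in>UNIV. (1 + pvar j ^ 2) ^ K) * h
      + pconst (\<epsilon> / 2) * (coshsum N - coshsum M) + pconst (\<epsilon> / 2) * (coshsum N - coshsum L)"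
    by (rule rpoly_eqI) (simp add: field_simps)
  also have "\<dots> \<in> sos"
    using \<open>\<epsilon> > 0\<close>
    by (intro sos_add[OF sos_add[OF sos_add[OF sos_add[OF M L] sos_mult[OF r h]]]]
          sos_pconst_mult coshsum_mono) (auto simp: N_def)
  finally show ?thesis by blast
qed

text \<open>At a fixed point the perturbation is at most \<open>\<epsilon> \<Sum>\<^sub>j exp (\<xi>\<^sub>j\<^sup>2)\<close>, whatever \<open>N\<close> is.\<close>

lemma sos_perturbations_imp_nonneg:
  fixes p :: "('n::finite) rpoly" and c :: "nat \<Rightarrow> real"
  assumes c: "\<And>n. c n \<le> 1 / fact n"
    and sos: "\<And>\<epsilon>. \<epsilon> > 0 \<Longrightarrow> \<exists>N::nat. p + pconst \<epsilon> * (\<Sum>n=0..N. \<Sum>j\<in>UNIV. pconst (c n) * pvar j ^ (2 * n)) \<in> sos"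
  shows "peval p \<xi> \<ge> 0"
proof (rule field_le_epsilon)
  fix \<epsilon> :: real assume "\<epsilon> > 0"
  define E where "E = (\<Sum>j\<in>UNIV. exp ((\<xi> $ j)\<^sup>2))"
  have E: "E > 0" unfolding E_def by (intro sum_pos) auto
  then obtain N :: nat where "p + pconst (\<epsilon> / E) * (\<Sum>n=0..N. \<Sum>j\<in>UNIV. pconst (c n) * pvar j ^ (2 * n)) \<in> sos"
    using sos[of "\<epsilon> / E"] \<open>\<epsilon> > 0\<close> by auto
  from peval_sos_nonneg[OF this, of \<xi>]
  have "0 \<le> peval p \<xi> + \<epsilon> / E * (\<Sum>n=0..N. \<Sum>j\<in>UNIV. c n * (\<xi> $ j) ^ (2 * n))"
    by (simp add: peval_sum)
  moreover have "\<epsilon> / E * (\<Sum>n=0..N. \<Sum>j\<in>UNIV. c n * (\<xi> $ j) ^ (2 * n)) \<le> \<epsilon> / E * E"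
  proof -
    have "(\<Sum>n=0..N. c n * x ^ (2 * n)) \<le> exp (x\<^sup>2)" for x :: real
    proof -
      have "(\<Sum>n=0..N. c n * x ^ (2 * n)) \<le> (\<Sum>n=0..N. (x\<^sup>2) ^ n /\<^sub>R fact n)"
      proof (rule sum_mono)
        fix n
        have "c n * x ^ (2 * n) \<le> 1 / fact n * x ^ (2 * n)"
          by (intro mult_right_mono c) (simp add: power_mult)
        then show "c n * x ^ (2 * n) \<le> (x\<^sup>2) ^ n /\<^sub>R fact n"
          unfolding power_mult by (simp add: divide_inverse)
      qed
      also have "\<dots> \<le> suminf (\<lambda>n. (x\<^sup>2) ^ n /\<^sub>R fact n)"
        by (intro sum_le_suminf summable_exp_generic) auto
      finally show ?thesis by (simp add: exp_def)
    qed
    then have "(\<Sum>n=0..N. \<Sum>j\<in>UNIV. c n * (\<xi> $ j) ^ (2 * n)) \<le> E"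
      unfolding E_def by (subst sum.swap) (rule sum_mono)
    then show ?thesis
      using E \<open>\<epsilon> > 0\<close> by (intro mult_left_mono) auto
  qed
  ultimately show "0 \<le> peval p \<xi> + \<epsilon>"
    using E by simp
qed

section \<open>The equivalence\<close>

theorem theorem1:
  fixes p :: "('n::finite) rpoly"
  shows "((\<forall>\<xi> :: real ^ 'n. peval p \<xi> \<ge> 0)
          \<longleftrightarrow> (\<forall>\<epsilon>>0. \<exists>N::nat.
                p + pconst \<epsilon> * (\<Sum>n=0..N. \<Sum>j\<in>UNIV. pconst (1 / fact n) * pvar j ^ (2 * n)) \<in> sos))
       \<and> ((\<forall>\<xi> :: real ^ 'n. peval p \<xi> \<ge> 0)
          \<longleftrightarrow> (\<forall>\<epsilon>>0. \<exists>N::nat.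
                p + pconst \<epsilon> * (\<Sum>n=0..N. \<Sum>j\<in>UNIV. pconst (1 / fact (2 * n)) * pvar j ^ (2 * n)) \<in> sos))"
    (is "(?nonneg \<longleftrightarrow> ?A) \<and> (?nonneg \<longleftrightarrow> ?B)")
proof -
  have fact_le: "1 / fact (2 * n) \<le> 1 / (fact n :: real)" for n
    by (intro divide_left_mono fact_mono mult_pos_pos) auto
  have 1: ?B if ?nonneg
    using nonneg_imp_sos_perturbation[of p] that by (simp add: coshsum_def)
  have 2: ?A if ?B
  proof (intro allI impI)
    fix \<epsilon> :: real assume "\<epsilon> > 0"
    with that obtain N :: nat where N: "p + pconst \<epsilon> * (\<Sum>n=0..N. \<Sum>j\<in>UNIV. pconst (1 / fact (2 * n)) * pvar j ^ (2 * n)) \<in> sos"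
      by blast
    have "p + pconst \<epsilon> * (\<Sum>n=0..N. \<Sum>j\<in>UNIV. pconst (1 / fact n) * pvar j ^ (2 * n))
       = (p + pconst \<epsilon> * (\<Sum>n=0..N. \<Sum>j\<in>UNIV. pconst (1 / fact (2 * n)) * pvar j ^ (2 * n)))
        + pconst \<epsilon> * (\<Sum>n=0..N. \<Sum>j\<in>UNIV. pconst (1 / fact n - 1 / fact (2 * n)) * pvar j ^ (2 * n))"
      by (rule rpoly_eqI) (simp add: peval_sum left_diff_distrib sum_subtractf right_diff_distrib)
    also have "\<dots> \<in> sos"
      using \<open>\<epsilon> > 0\<close> fact_le by (intro sos_add[OF N] sos_pconst_mult sos_sum sos_even_power) auto
    finally show "\<exists>N::nat. p + pconst \<epsilon> * (\<Sum>n=0..N. \<Sum>j\<in>UNIV. pconst (1 / fact n) * pvar j ^ (2 * n)) \<in> sos"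
      by blast
  qed
  have 3: ?nonneg if ?A
    using sos_perturbations_imp_nonneg[of "\<lambda>n. 1 / fact n" p] that by simp
  show ?thesis using 1 2 3 by blast
qed

end
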